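(* For the speed-scaled Euclidean TSPD model with drone speed factor $\alpha\ge1$, and every $h>0$, $$\beta_{\mathsf{TSPD}}\le\frac1h\int_0^\infty\int_0^1\int_0^1e^{-z_1}\sqrt{z_1^2+h^4(u_0-u_1)^2}\,du_0\,du_1\,dz_1.$$ Consequently, $$\beta_{\mathsf{TSPD}}\le\sqrt{\frac{2}{\sqrt3}}.$$
   Context: Traveling Salesman Problem with Drone (TSPD). Let $\|\cdot\|_T$ (truck metric) and $\|\cdot\|_D$ (drone metric) be norms on $\mathbb{R}^2$, and let $\mathcal X\subset\mathbb{R}^2$ be a finite set of customer points (nodes). In a solution each node is exactly one of: a truck node (visited only by the truck), a drone node (served only by the drone), or a combined node (visited by both vehicles; a synchronization point). A ring $r$ is given by two distinct combined nodes serving as start and end nodes, together with at most one drone node and any number (possibly zero) of truck nodes between them. In ring $r$ the truck follows a path $\mathcal T_r$ from the start node through all truck nodes of the ring (in some order) to the end node, and, if a drone node is present, the drone follows the path $\mathcal D_r$ from the start node to the drone node to the end node. With $t(\mathcal T_r)$ the sum of the $\|\cdot\|_T$-lengths of the edges of $\mathcal T_r$ and $d(\mathcal D_r)$ the sum of the $\|\cdot\|_D$-lengths of the edges of $\mathcal D_r$, the cost $c(r)$ of the ring is the minimum, over the choices of $\mathcal T_r,\mathcal D_r$, of $\max\{t(\mathcal T_r),d(\mathcal D_r)\}$ if the ring contains a drone node, and of $t(\mathcal T_r)$ otherwise. A feasible solution for $\mathcal X$ is a set $\mathcal R(\mathcal X)$ of rings that together cover all points of $\mathcal X$ and are concatenated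 through their combined nodes to form a single cyclic tour; each point of $\mathcal X$ is served exactly once: a combined node is shared by exactly two adjacent rings, and every other point belongs to exactly one ring. The optimal makespan is $\mathsf{TSPD}(\mathcal X)=\min_{\mathcal R(\mathcal X)}\sum_{r\in\mathcal R(\mathcal X)}c(r)$. Conventions: $\mathsf{TSPD}(\mathcal X)=0$ if $|\mathcal X|\le1$, and $\mathsf{TSPD}(\{x,y\})=2\|x-y\|_T$ for $x\ne y$. Speed-scaled Euclidean model: $\|p\|_T=\|p\|_2$ and $\|p\|_D=\frac1\alpha\|p\|_2$, where $\alpha\ge1$. Asymptotic constant: for $X_1,X_2,\ldots$ i.i.d. uniform on $[0,1]^2$, $\beta_{\mathsf{TSPD}}$ is the constant such that $\mathsf{TSPD}(\{X_1,\ldots,X_n\})/\sqrt n\to\beta_{\mathsf{TSPD}}$ almost surely and in expectation as $n\to\infty$ (this limit is known to exist). *)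

theory Defs
  imports "HOL-Probability.Probability" "HOL-Combinatorics.Multiset_Permutations"
begin

text \<open>
  The truck and drone norms are parameters \<open>NT\<close>, \<open>ND\<close> of the general problem.
  Rings carry an orientation, given by their start and end nodes.
\<close>

type_synonym point = "real ^ 2"

datatype ring =
  Ring (start_node: point) (end_node: point) (truck_nodes: "point set") (drone_node: "point option")

definition inner_nodes :: "ring \<Rightarrow> point set" where
  "inner_nodes r = truck_nodes r \<union> set_option (drone_node r)"

definition valid_ring :: "ring \<Rightarrow> bool" where
  "valid_ring r \<longleftrightarrow>
     start_node r \<noteq> end_node r \<and> finite (truck_nodes r) \<and>
     truck_nodes r \<inter> set_option (drone_node r) = {} \<and>
     start_node r \<notin> inner_nodes r \<and> end_node r \<notin> inner_nodes r"

fun path_length :: "(point \<Rightarrow> real) \<Rightarrow> point list \<Rightarrow> real" where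
  "path_length N (p # q # ps) = N (q - p) + path_length N (q # ps)"
| "path_length N _ = 0"

definition truck_paths :: "ring \<Rightarrow> point list set" where
  "truck_paths r =
     (\<lambda>ts. start_node r # ts @ [end_node r]) ` permutations_of_set (truck_nodes r)"

text \<open>The drone path is determined by the ring, so only the truck path is minimized over.\<close>

definition ring_cost :: "(point \<Rightarrow> real) \<Rightarrow> (point \<Rightarrow> real) \<Rightarrow> ring \<Rightarrow> real" where
  "ring_cost NT ND r =
     Min ((\<lambda>p. case drone_node r of
                  None \<Rightarrow> path_length NT p
                | Some d \<Rightarrow> max (path_length NT p)
                                (path_length ND [start_node r, d, end_node r])) ` truck_paths r)"

text \<open>
  The list \<open>rs\<close> enumerates the rings along the cyclic tour. Since every ring ends where its
  successor starts, the combined nodes are exactly the start nodes, and their distinctness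
  says that each of them is shared by exactly two adjacent rings.
\<close>

definition feasible_solution :: "point set \<Rightarrow> ring set \<Rightarrow> bool" where
  "feasible_solution X R \<longleftrightarrow>
     (\<exists>rs. set rs = R \<and> distinct (map start_node rs) \<and>
        (\<forall>i<length rs. end_node (rs ! i) = start_node (rs ! (Suc i mod length rs)))) \<and>
     (\<forall>r\<in>R. valid_ring r) \<and>
     (\<forall>r\<in>R. inner_nodes r \<inter> start_node ` R = {}) \<and>
     (\<forall>r\<in>R. \<forall>r'\<in>R. r \<noteq> r' \<longrightarrow> inner_nodes r \<inter> inner_nodes r' = {}) \<and>
     start_node ` R \<union> (\<Union>r\<in>R. inner_nodes r) = X"

definition TSPD :: "(point \<Rightarrow> real) \<Rightarrow> (point \<Rightarrow> real) \<Rightarrow> point set \<Rightarrow> real" where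
  "TSPD NT ND X =
     (if card X \<le> 1 then 0
      else Min ((\<lambda>R. \<Sum>r\<in>R. ring_cost NT ND r) ` {R. feasible_solution X R}))"

definition TSPD_euclid :: "real \<Rightarrow> point set \<Rightarrow> real" where
  "TSPD_euclid \<alpha> = TSPD norm (\<lambda>p. 1 / \<alpha> * norm p)"

text \<open>The minimum in \<open>TSPD\<close> ranges over a finite nonempty set.\<close>

lemma feasible_solutionD:
  assumes f: "feasible_solution X R"
  shows "start_node ` R \<union> (\<Union>r\<in>R. inner_nodes r) = X"
    and "r \<in> R \<Longrightarrow> valid_ring r"
    and "r \<in> R \<Longrightarrow> end_node r \<in> start_node ` R"
proof -
  from f obtain rs where rs: "set rs = R"
    "\<forall>i<length rs. end_node (rs ! i) = start_node (rs ! (Suc i mod length rs))"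
    unfolding feasible_solution_def by (elim conjE exE)
  show "start_node ` R \<union> (\<Union>r\<in>R. inner_nodes r) = X" "r \<in> R \<Longrightarrow> valid_ring r"
    using f unfolding feasible_solution_def by simp_all
  show "end_node r \<in> start_node ` R" if r: "r \<in> R"
  proof -
    obtain i where i: "i < length rs" "rs ! i = r"
      using r rs(1) by (metis in_set_conv_nth)
    then have "Suc i mod length rs < length rs"
      by (intro mod_less_divisor) auto
    then show ?thesis using rs i by (metis imageI nth_mem)
  qed
qed

lemma finite_feasible_solutions:
  assumes "finite X"
  shows "finite {R. feasible_solution X R}"
proof -
  let ?C = "(\<lambda>(s, e, T, d). Ring s e T d) ` (X \<times> X \<times> Pow X \<times> insert None (Some ` X))"
  have "R \<subseteq> ?C" if f: "feasible_solution X R" for R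
  proof
    fix r assume r: "r \<in> R"
    note X = feasible_solutionD(1)[OF f]
    have "end_node r \<in> start_node ` R" by (rule feasible_solutionD(3)[OF f r])
    then have e: "end_node r \<in> X" and s: "start_node r \<in> X" and I: "inner_nodes r \<subseteq> X"
      using X r by blast+
    have "truck_nodes r \<in> Pow X" "drone_node r \<in> insert None (Some ` X)"
      using I by (cases "drone_node r"; auto simp: inner_nodes_def)+
    then have "(start_node r, end_node r, truck_nodes r, drone_node r)
        \<in> X \<times> X \<times> Pow X \<times> insert None (Some ` X)"
      using e s by blast
    then have "(\<lambda>(s, e, T, d). Ring s e T d)
        (start_node r, end_node r, truck_nodes r, drone_node r) \<in> ?C"
      by (rule imageI)
    then show "r \<in> ?C" by simp
  qed
  then have "{R. feasible_solution X R} \<subseteq> Pow ?C" by blast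
  moreover have "finite (Pow ?C)" using assms by simp
  ultimately show ?thesis by (rule finite_subset)
qed

lemma feasible_solution_exists:
  assumes "card X \<ge> 2"
  shows "\<exists>R. feasible_solution X R"
proof -
  have "finite X" using assms by (metis card.infinite not_numeral_le_zero)
  then obtain xs where xs: "set xs = X" "distinct xs"
    using finite_distinct_list by blast
  define n where "n = length xs"
  have n: "n \<ge> 2" using assms xs distinct_card n_def by metis
  define f where "f i = Ring (xs ! i) (xs ! (Suc i mod n)) {} None" for i
  define rs where "rs = map f [0..<n]"
  have m: "Suc i mod n < n" for i using n by simp
  have ne: "xs ! i \<noteq> xs ! (Suc i mod n)" if "i < n" for i
  proof -
    have "i \<noteq> Suc i mod n" using n that by (cases "Suc i = n") auto
    then show ?thesis using that m[of i] xs(2) by (simp add: n_def nth_eq_iff_index_eq)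
  qed
  have st: "map start_node rs = xs"
    by (rule nth_equalityI) (auto simp: rs_def f_def n_def)
  have inner: "inner_nodes r = {}" if "r \<in> set rs" for r
    using that by (auto simp: rs_def f_def inner_nodes_def)
  have "feasible_solution X (set rs)"
    unfolding feasible_solution_def
  proof (intro conjI)
    show "\<exists>rs'. set rs' = set rs \<and> distinct (map start_node rs') \<and>
        (\<forall>i<length rs'. end_node (rs' ! i) = start_node (rs' ! (Suc i mod length rs')))"
      using st xs m by (intro exI[of _ rs]) (auto simp: rs_def f_def)
    show "\<forall>r\<in>set rs. valid_ring r"
      using ne by (auto simp: rs_def f_def valid_ring_def inner_nodes_def)
    show "start_node ` set rs \<union> (\<Union>r\<in>set rs. inner_nodes r) = X"
      using inner image_set[of start_node rs] st xs(1) by simp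
  qed (use inner in auto)
  then show ?thesis by blast
qed

text \<open>The convention for two customers is a consequence of the definition.\<close>

lemma TSPD_pair:
  assumes "x \<noteq> y" and sym: "NT (x - y) = NT (y - x)"
  shows "TSPD NT ND {x, y} = 2 * NT (x - y)"
proof -
  let ?R = "{Ring x y {} None, Ring y x {} None}"
  have uniq: "R = ?R" if f: "feasible_solution {x, y} R" for R
  proof -
    note X = feasible_solutionD(1)[OF f] and v = feasible_solutionD(2)[OF f]
      and end_in = feasible_solutionD(3)[OF f]
    have key: "r = Ring x y {} None \<or> r = Ring y x {} None" if r: "r \<in> R" for r
    proof -
      have s: "start_node r \<in> {x, y}" "end_node r \<in> {x, y}" "inner_nodes r \<subseteq> {x, y}"
        using end_in[OF r] unfolding X[symmetric] using r by blast+
      have ne: "start_node r \<noteq> end_node r"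
        and ni: "start_node r \<notin> inner_nodes r" "end_node r \<notin> inner_nodes r"
        using v[OF r] by (auto simp: valid_ring_def)
      have "start_node r = x \<and> end_node r = y \<or> start_node r = y \<and> end_node r = x"
        using s(1,2) ne by auto
      then have "z \<notin> inner_nodes r" for z
        using s(3) ni by (metis insertE singletonD subsetD)
      then have "inner_nodes r = {}" by blast
      then have "truck_nodes r = {}" "drone_node r = None"
        by (cases "drone_node r"; auto simp: inner_nodes_def)+
      then have "r = Ring (start_node r) (end_node r) {} None"
        by (metis ring.collapse)
      then show ?thesis
        using s(1,2) ne by (metis insertE singletonD)
    qed
    have "R \<noteq> {}" using X by auto
    then obtain r where r: "r \<in> R" by blast
    have "Ring x y {} None \<in> R \<and> Ring y x {} None \<in> R"
    proof -
      obtain r' where r': "r' \<in> R" "end_node r = start_node r'"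
        using end_in[OF r] by auto
      show ?thesis using key[OF r] key[OF r'(1)] r r' \<open>x \<noteq> y\<close> by (elim disjE) simp_all
    qed
    then show ?thesis using key by blast
  qed
  have c: "card {x, y} = 2" using \<open>x \<noteq> y\<close> by simp
  then obtain R where "feasible_solution {x, y} R"
    using feasible_solution_exists by (metis order_refl)
  then have "{R. feasible_solution {x, y} R} = {?R}" using uniq by blast
  then show ?thesis
    using c \<open>x \<noteq> y\<close> sym by (simp add: TSPD_def ring_cost_def truck_paths_def)
qed

definition iid_uniform_unit_square :: "'a measure \<Rightarrow> (nat \<Rightarrow> 'a \<Rightarrow> point) \<Rightarrow> bool" where
  "iid_uniform_unit_square M X \<longleftrightarrow>
     prob_space M \<and> prob_space.indep_vars M (\<lambda>_. borel) X UNIV \<and>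
     (\<forall>i. distr M borel (X i) = uniform_measure lborel (cbox 0 1))"

text \<open>
  \<open>is_beta_TSPD \<alpha> M X \<beta>\<close>: along the sequence \<open>X\<close> (indexed from 0), \<open>\<beta>\<close> is the limit of the
  normalized optimal makespan, both almost surely and in expectation.
\<close>

definition is_beta_TSPD :: "real \<Rightarrow> 'a measure \<Rightarrow> (nat \<Rightarrow> 'a \<Rightarrow> point) \<Rightarrow> real \<Rightarrow> bool" where
  "is_beta_TSPD \<alpha> M X \<beta> \<longleftrightarrow>
     (AE \<omega> in M. (\<lambda>n. TSPD_euclid \<alpha> ((\<lambda>i. X i \<omega>) ` {..<n}) / sqrt (real n)) \<longlonglongrightarrow> \<beta>) \<and>
     (\<lambda>n. (\<integral>\<omega>. TSPD_euclid \<alpha> ((\<lambda>i. X i \<omega>) ` {..<n}) \<partial>M) / sqrt (real n)) \<longlonglongrightarrow> \<beta>"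

end

theory Submission
  imports Defs "HOL-Real_Asymp.Real_Asymp"
begin

text \<open>
  The drone is left idle, so the truck only has to follow a good tour, and the strip heuristic
  provides one. Cut the unit square into \<open>k = \<lceil>\<surd>n / h\<rceil>\<close> horizontal strips of width \<open>w = 1 / k\<close> and
  traverse them alternately from left to right and from right to left, visiting the points of each
  strip in the order of their first coordinates. A point at horizontal distance \<open>s\<close> is the next one in
  its strip only if the \<open>n - 2\<close> remaining points avoid a box of area \<open>w s\<close>, which has probability
  \<open>(1 - w s) ^ (n - 2) \<le> exp (- w (n - 2) s)\<close>; substituting \<open>z = w (n - 2) s\<close> turns the expected
  total length of these edges into \<open>\<surd>n / h\<close> times the integral, asymptotically. The edges at the
  ends of the strips cost \<open>o(\<surd>n)\<close>: the leftmost \<open>\<delta>\<close> of a strip contains a point with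
  probability at least \<open>1 - exp (- n w \<delta>)\<close>, and \<open>\<delta> = n powr (- 1 / 4)\<close> makes both this failure
  probability and \<open>\<delta>\<close> tend to \<open>0\<close>.
\<close>

section \<open>Tours and path lengths\<close>

lemma path_length_append_Cons:
  "path_length N (xs @ p # ys) = path_length N (xs @ [p]) + path_length N (p # ys)"
  by (induction N xs rule: path_length.induct) auto

lemma path_length_nonneg: "path_length norm xs \<ge> 0"
  by (induction "norm :: point \<Rightarrow> real" xs rule: path_length.induct) auto

lemma path_length_conv_sum:
  "path_length N xs = (\<Sum>i<length xs - 1. N (xs ! Suc i - xs ! i))"
proof (induction N xs rule: path_length.induct)
  case (1 N p q ps)
  then show ?case by (simp add: sum.lessThan_Suc_shift del: sum.lessThan_Suc)
qed auto

text \<open>The triangle inequality at \<open>p\<close>; at an end of the path, \<open>p\<close> at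
  most adds an edge. Auxiliary corner points can therefore be inserted into a tour whose length is
  to be bounded from above.\<close>

lemma path_length_insert_ge:
  "path_length norm (xs @ ys) \<le> path_length norm (xs @ p # ys)"
proof (cases xs rule: rev_cases)
  case Nil
  then show ?thesis by (cases ys) auto
next
  case (snoc as a)
  show ?thesis
  proof (cases ys)
    case Nil
    then show ?thesis
      using path_length_append_Cons[of norm as a "[p]"] snoc by simp
  next
    case (Cons b bs)
    have "norm (b - a) \<le> norm (p - a) + norm (b - p)"
      using norm_triangle_ineq[of "p - a" "b - p"] by simp
    then show ?thesis
      using path_length_append_Cons[of norm as a "p # b # bs"]
        path_length_append_Cons[of norm as a "b # bs"] snoc Cons by simp
  qed
qed

lemma path_length_rev: "path_length norm (rev xs) = path_length norm xs"
proof (induction "norm :: point \<Rightarrow> real" xs rule: path_length.induct)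
  case (1 p q ps)
  then show ?case
    using path_length_append_Cons[of norm "rev ps" q "[p]"] by (simp add: norm_minus_commute)
qed auto

text \<open>One ring for each pair of cyclically consecutive points, without inner nodes: every
  customer is a combined node, and the makespan is the length of the truck tour. A single point is
  covered by the convention that its makespan is \<open>0\<close>.\<close>

lemma TSPD_le_tour_length:
  assumes xs: "distinct xs" "xs \<noteq> []"
  shows "TSPD norm ND (set xs) \<le> path_length norm (xs @ [hd xs])"
proof (cases "length xs \<le> 1")
  case True
  then show ?thesis using xs path_length_nonneg by (simp add: TSPD_def distinct_card)
next
  case False
  define n where "n = length xs"
  have n: "n \<ge> 2" using False n_def by simp
  define f where "f i = Ring (xs ! i) (xs ! (Suc i mod n)) {} None" for i
  define rs where "rs = map f [0..<n]"
  have m: "Suc i mod n < n" for i using n by simp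
  have ne: "xs ! i \<noteq> xs ! (Suc i mod n)" if "i < n" for i
  proof -
    have "i \<noteq> Suc i mod n" using n that by (cases "Suc i = n") auto
    then show ?thesis using that m[of i] xs(1) by (simp add: n_def nth_eq_iff_index_eq)
  qed
  have st: "map start_node rs = xs"
    by (rule nth_equalityI) (auto simp: rs_def f_def n_def)
  have inner: "inner_nodes r = {}" if "r \<in> set rs" for r
    using that by (auto simp: rs_def f_def inner_nodes_def)
  have feas: "feasible_solution (set xs) (set rs)"
    unfolding feasible_solution_def
  proof (intro conjI)
    show "\<exists>rs'. set rs' = set rs \<and> distinct (map start_node rs') \<and>
        (\<forall>i<length rs'. end_node (rs' ! i) = start_node (rs' ! (Suc i mod length rs')))"
      using st xs m by (intro exI[of _ rs]) (auto simp: rs_def f_def)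
    show "\<forall>r\<in>set rs. valid_ring r"
      using ne by (auto simp: rs_def f_def valid_ring_def inner_nodes_def)
    show "start_node ` set rs \<union> (\<Union>r\<in>set rs. inner_nodes r) = set xs"
      using inner image_set[of start_node rs] st by simp
  qed (use inner in auto)
  have "distinct rs" using st xs(1) distinct_map by metis
  \<comment> \<open>Without truck nodes a ring has a single truck path. Indexing into
    \<open>xs @ [hd xs]\<close> includes the edge that closes the tour, where
    \<open>Suc i mod n\<close> is \<open>0\<close>.\<close>
  have cost: "ring_cost norm ND (f i) = norm ((xs @ [hd xs]) ! Suc i - (xs @ [hd xs]) ! i)"
    if "i < n" for i
    using that xs n by (cases "Suc i = n")
      (auto simp: f_def ring_cost_def truck_paths_def nth_append n_def hd_conv_nth)
  have "TSPD norm ND (set xs) = Min ((\<lambda>R. \<Sum>r\<in>R. ring_cost norm ND r) ` {R. feasible_solution (set xs) R})"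
    using False xs by (simp add: TSPD_def distinct_card)
  also have "\<dots> \<le> (\<Sum>r\<in>set rs. ring_cost norm ND r)"
    using feas by (intro Min_le finite_imageI finite_feasible_solutions) auto
  also have "\<dots> = (\<Sum>i<n. ring_cost norm ND (f i))"
    using \<open>distinct rs\<close>
    by (simp add: rs_def distinct_map sum.reindex lessThan_atLeast0)
  also have "\<dots> = path_length norm (xs @ [hd xs])"
    using cost by (simp add: path_length_conv_sum n_def)
  finally show ?thesis .
qed

text \<open>The edge that closes the tour is replaced by a detour through \<open>b\<close> and
  \<open>a\<close>. What remains to be bounded is an open path between two fixed points and the jump
  from \<open>b\<close> back to \<open>a\<close>.\<close>

lemma closed_tour_le:
  assumes "xs \<noteq> []"
  shows "path_length norm (xs @ [hd xs]) \<le> path_length norm (a # xs @ [b]) + norm (b - a)"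
proof -
  obtain y ys where xs: "xs = y # ys" using assms by (cases xs) auto
  have "path_length norm (xs @ [hd xs]) \<le> path_length norm (xs @ [b, a, y])"
    using path_length_insert_ge[of xs "[y]" b] path_length_insert_ge[of "xs @ [b]" "[y]" a] xs
    by simp
  also have "\<dots> = path_length norm (a # xs @ [b]) + norm (b - a)"
    using path_length_append_Cons[of norm xs b "[a, y]"] xs by (simp add: norm_minus_commute)
  finally show ?thesis .
qed

text \<open>Between the blocks \<open>j\<close> and \<open>Suc j\<close> the points
  \<open>b j\<close> and \<open>a (Suc j)\<close> are inserted, which does not shorten the path. The
  total then splits into one path per block, each depending only on its own points and
  corners.\<close>

lemma path_length_concat_le:
  "path_length norm (a 0 # concat (map B [0..<Suc m]) @ [b m])
    \<le> (\<Sum>j\<le>m. path_length norm (a j # B j @ [b j])) + (\<Sum>j<m. norm (a (Suc j) - b j))"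
proof (induction m)
  case (Suc m)
  let ?C = "concat (map B [0..<Suc m])"
  have "path_length norm (a 0 # ?C @ B (Suc m) @ [b (Suc m)])
      \<le> path_length norm (a 0 # ?C @ b m # a (Suc m) # B (Suc m) @ [b (Suc m)])"
    using path_length_insert_ge[of "a 0 # ?C" "B (Suc m) @ [b (Suc m)]" "b m"]
      path_length_insert_ge[of "a 0 # ?C @ [b m]" "B (Suc m) @ [b (Suc m)]" "a (Suc m)"]
    by simp
  also have "\<dots> = path_length norm (a 0 # ?C @ [b m]) + norm (a (Suc m) - b m)
      + path_length norm (a (Suc m) # B (Suc m) @ [b (Suc m)])"
    using path_length_append_Cons[of norm "a 0 # ?C" "b m" "a (Suc m) # B (Suc m) @ [b (Suc m)]"] by simp
  finally show ?case using Suc by simp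
qed simp

section \<open>The strip tour\<close>

abbreviation pt :: "real \<Rightarrow> real \<Rightarrow> point" where "pt x y \<equiv> vector [x, y]"

lemma norm_le_abs_coords: "norm (p :: point) \<le> \<bar>p $ 1\<bar> + \<bar>p $ 2\<bar>"
  using norm_le_l1_cart[of p] by (simp add: sum_2)

text \<open>Contains the edges of every path that visits the points of \<open>S\<close> once each in
  the order of their first coordinates, yet needs no sorting. Ties produce additional pairs, which
  is harmless in an upper bound.\<close>

definition successor_pairs :: "point set \<Rightarrow> (point \<times> point) set" where
  "successor_pairs S = {(p, q) \<in> S \<times> S. p \<noteq> q \<and> p $ 1 \<le> q $ 1 \<and>
     (\<forall>r\<in>S. \<not> (p $ 1 < r $ 1 \<and> r $ 1 < q $ 1))}"

text \<open>\<open>L\<close> lists \<open>S\<close> by first coordinate, so its edges are distinct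
  successor pairs. The first edge starts at the left corner; its vertical part is at most
  \<open>w\<close>, its horizontal part at most \<open>\<delta>\<close> if some point lies within
  \<open>\<delta>\<close> of the left side, and otherwise at most \<open>1\<close>, for which the
  indicator pays. The last edge is symmetric. For empty \<open>S\<close> both indicators are
  \<open>1\<close> and cover the edge between the corners.\<close>

lemma strip_path:
  assumes fin: "finite S" and S: "\<And>p. p \<in> S \<Longrightarrow> 0 \<le> p $ 1 \<and> p $ 1 \<le> 1 \<and> y \<le> p $ 2 \<and> p $ 2 \<le> y + w"
    and \<delta>: "0 \<le> \<delta>" and w: "0 \<le> w"
  obtains L where "set L = S" "distinct L"
    "path_length norm (pt 0 y # L @ [pt 1 y]) \<le>
       (\<Sum>(p, q)\<in>successor_pairs S. norm (q - p))
       + of_bool (\<forall>p\<in>S. \<delta> < p $ 1) + of_bool (\<forall>p\<in>S. p $ 1 < 1 - \<delta>) + 2 * (\<delta> + w)"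
proof -
  obtain L0 where "set L0 = S" "distinct L0"
    using finite_distinct_list[OF fin] by blast
  define L where "L = sort_key (\<lambda>p. p $ 1) L0"
  have L: "set L = S" "distinct L" and sorted: "sorted (map (\<lambda>p. p $ 1) L)"
    using \<open>set L0 = S\<close> \<open>distinct L0\<close> by (simp_all add: L_def)
  have mono: "L ! i $ 1 \<le> L ! j $ 1" if "i \<le> j" "j < length L" for i j
    using sorted_nth_mono[OF sorted, of i j] that by simp
  let ?\<Sigma> = "\<Sum>(p, q)\<in>successor_pairs S. norm (q - p)"
  have finP: "finite (successor_pairs S)"
    by (rule finite_subset[of _ "S \<times> S"]) (auto simp: successor_pairs_def fin)
  have path: "path_length norm L \<le> ?\<Sigma>"
  proof -
    let ?f = "\<lambda>i. (L ! i, L ! Suc i)"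
    have inj: "inj_on ?f {..<length L - 1}"
      using L(2) by (auto simp: inj_on_def nth_eq_iff_index_eq)
    have sub: "?f ` {..<length L - 1} \<subseteq> successor_pairs S"
    proof clarsimp
      fix i assume i: "i < length L - Suc 0"
      have "\<not> (L ! i $ 1 < r $ 1 \<and> r $ 1 < L ! Suc i $ 1)" if r: "r \<in> S" for r
      proof -
        have i: "i < length L" using i by simp
        obtain j where j: "j < length L" "r = L ! j" using r L(1) by (metis in_set_conv_nth)
        show ?thesis
          using mono[of j i] mono[of "Suc i" j] i j by (cases "j \<le> i") (auto simp: not_le)
      qed
      moreover have "L ! i \<noteq> L ! Suc i" using i L(2) by (simp add: nth_eq_iff_index_eq)
      moreover have "L ! i \<in> S" "L ! Suc i \<in> S" using i L(1) by (auto simp flip: L(1))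
      ultimately show "(L ! i, L ! Suc i) \<in> successor_pairs S"
        using mono[of i "Suc i"] i by (auto simp: successor_pairs_def)
    qed
    have "path_length norm L = (\<Sum>(p, q)\<in>?f ` {..<length L - 1}. norm (q - p))"
      by (subst sum.reindex[OF inj]) (simp add: path_length_conv_sum)
    also have "\<dots> \<le> ?\<Sigma>" by (rule sum_mono2) (use sub finP in auto)
    finally show ?thesis .
  qed
  have "path_length norm (pt 0 y # L @ [pt 1 y]) \<le>
       ?\<Sigma>
       + of_bool (\<forall>p\<in>S. \<delta> < p $ 1) + of_bool (\<forall>p\<in>S. p $ 1 < 1 - \<delta>) + 2 * (\<delta> + w)"
  proof (cases "L = []")
    case True
    then have "S = {}" using L by simp
    moreover have "norm (pt 1 y - pt 0 y) \<le> 1"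
      using norm_le_abs_coords[of "pt 1 y - pt 0 y"] by simp
    ultimately show ?thesis using True \<delta> w by (simp add: successor_pairs_def)
  next
    case False
    then have split: "L = hd L # tl L" "L = butlast L @ [last L]" by simp_all
    have hl: "hd L \<in> S" "last L \<in> S" using False L(1) by auto
    have "norm (hd L - pt 0 y) \<le> \<delta> + w + of_bool (\<forall>p\<in>S. \<delta> < p $ 1)"
    proof -
      have "hd L $ 1 \<le> p $ 1" if "p \<in> S" for p
        using that mono[of 0] False L(1) by (metis hd_conv_nth in_set_conv_nth le0)
      then have "hd L $ 1 \<le> \<delta> + of_bool (\<forall>p\<in>S. \<delta> < p $ 1)"
        using S[OF hl(1)] \<delta> by force
      then show ?thesis
        using norm_le_abs_coords[of "hd L - pt 0 y"] S[OF hl(1)] by simp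
    qed
    moreover have "norm (pt 1 y - last L) \<le> \<delta> + w + of_bool (\<forall>p\<in>S. p $ 1 < 1 - \<delta>)"
    proof -
      have "p $ 1 \<le> last L $ 1" if p: "p \<in> S" for p
      proof -
        obtain j where "j < length L" "p = L ! j" using p L(1) by (metis in_set_conv_nth)
        then show ?thesis using mono[of j "length L - 1"] False by (simp add: last_conv_nth)
      qed
      then have "1 - last L $ 1 \<le> \<delta> + of_bool (\<forall>p\<in>S. p $ 1 < 1 - \<delta>)"
        using S[OF hl(2)] \<delta> by force
      then show ?thesis
        using norm_le_abs_coords[of "pt 1 y - last L"] S[OF hl(2)] by simp
    qed
    moreover have "path_length norm (pt 0 y # L @ [pt 1 y]) =
        norm (hd L - pt 0 y) + path_length norm L + norm (pt 1 y - last L)"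
    proof -
      have "path_length norm (pt 0 y # L @ [pt 1 y]) = norm (hd L - pt 0 y) + path_length norm (L @ [pt 1 y])"
        by (subst (1 2) split(1)) simp
      also have "path_length norm (L @ [pt 1 y]) = path_length norm L + norm (pt 1 y - last L)"
        using path_length_append_Cons[of norm "butlast L" "last L" "[pt 1 y]"] False
        by (metis append_Cons append_Nil append_assoc append_butlast_last_id path_length.simps(1)
            path_length.simps(3) add.right_neutral)
      finally show ?thesis by simp
    qed
    ultimately show ?thesis using path by (simp add: algebra_simps)
  qed
  with that L show ?thesis by blast
qed

text \<open>Open on all sides. With the height bounds of a strip, a point of the cell is interior to
  that strip, so it is counted there whichever strip receives the points on a common border; and the
  endpoints of an edge lie outside the cell between them.\<close>

definition cell :: "real \<Rightarrow> real \<Rightarrow> real \<Rightarrow> real \<Rightarrow> point set" where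
  "cell a b c d = {p. a < p $ 1 \<and> p $ 1 < b \<and> c < p $ 2 \<and> p $ 2 < d}"

text \<open>\<open>\<sigma>\<close> chooses a strip for each point; the closed bounds in
  \<open>strip\<close> allow either choice on a common border. The constant \<open>5\<close>
  consists of \<open>2\<close> for the vertical parts of the \<open>2 * k\<close> edges at the strip
  ends, at most \<open>1 / k\<close> each, of \<open>1\<close> for the links between consecutive
  strips, and of \<open>2\<close> for the return from the last corner to the first.\<close>

lemma TSPD_le_strip_sum:
  fixes k :: nat and \<delta> :: real and \<sigma> :: "point \<Rightarrow> nat"
  assumes fin: "finite S" and k: "k > 0" and \<delta>: "0 \<le> \<delta>"
    and sq: "\<And>p. p \<in> S \<Longrightarrow> 0 \<le> p $ 1 \<and> p $ 1 \<le> 1"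
    and part: "\<And>p. p \<in> S \<Longrightarrow> \<sigma> p < k"
    and strip: "\<And>p. p \<in> S \<Longrightarrow> \<sigma> p / k \<le> p $ 2 \<and> p $ 2 \<le> Suc (\<sigma> p) / k"
  shows "TSPD norm ND S \<le>
     (\<Sum>j<k. (\<Sum>(p, q)\<in>successor_pairs {p\<in>S. \<sigma> p = j}. norm (q - p))
       + of_bool (\<forall>p\<in>S. \<sigma> p = j \<longrightarrow> \<delta> < p $ 1)
       + of_bool (\<forall>p\<in>S. \<sigma> p = j \<longrightarrow> p $ 1 < 1 - \<delta>)) + 2 * \<delta> * k + 5"
proof (cases "S = {}")
  case True
  then show ?thesis using \<delta> by (auto simp: TSPD_def intro!: add_nonneg_nonneg sum_nonneg mult_nonneg_nonneg)
next
  case False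
  obtain m where km: "k = Suc m" using k by (cases k) auto
  let ?E = "\<lambda>j. (\<Sum>(p, q)\<in>successor_pairs {p\<in>S. \<sigma> p = j}. norm (q - p))
       + of_bool (\<forall>p\<in>S. \<sigma> p = j \<longrightarrow> \<delta> < p $ 1)
       + of_bool (\<forall>p\<in>S. \<sigma> p = j \<longrightarrow> p $ 1 < 1 - \<delta>)"
  define P where "P j L \<longleftrightarrow> set L = {p\<in>S. \<sigma> p = j} \<and> distinct L \<and>
     path_length norm (pt 0 (j/k) # L @ [pt 1 (j/k)]) \<le> ?E j + 2 * (\<delta> + 1 / k)" for j :: nat and L
  have "\<exists>L. P j L" for j
  proof -
    obtain L where "set L = {p\<in>S. \<sigma> p = j}" "distinct L"
      "path_length norm (pt 0 (j/k) # L @ [pt 1 (j/k)]) \<le>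
       (\<Sum>(p, q)\<in>successor_pairs {p\<in>S. \<sigma> p = j}. norm (q - p))
       + of_bool (\<forall>p\<in>{p\<in>S. \<sigma> p = j}. \<delta> < p $ 1)
       + of_bool (\<forall>p\<in>{p\<in>S. \<sigma> p = j}. p $ 1 < 1 - \<delta>) + 2 * (\<delta> + 1 / k)"
      by (rule strip_path[of "{p\<in>S. \<sigma> p = j}" "j/k" "1/k" \<delta>])
        (use fin \<delta> sq strip in \<open>auto simp: add_divide_distrib add.commute\<close>)
    moreover have "(\<forall>p\<in>{p\<in>S. \<sigma> p = j}. Q p) \<longleftrightarrow> (\<forall>p\<in>S. \<sigma> p = j \<longrightarrow> Q p)" for Q by auto
    ultimately show ?thesis by (intro exI[of _ L]) (simp only: simp_thms P_def)
  qed
  then obtain L where "\<And>j. P j (L j)" by metis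
  then have L: "\<And>j. set (L j) = {p\<in>S. \<sigma> p = j}" "\<And>j. distinct (L j)"
    "\<And>j. path_length norm (pt 0 (j/k) # L j @ [pt 1 (j/k)]) \<le> ?E j + 2 * (\<delta> + 1 / k)"
    by (simp_all only: P_def)
  \<comment> \<open>\<open>a j\<close> and \<open>b j\<close> are the corners where the alternating tour enters and leaves strip \<open>j\<close>.\<close>
  define B where "B j = (if even j then L j else rev (L j))" for j
  define a where "a j = (if even j then pt 0 (j/k) else pt 1 (j/k))" for j :: nat
  define b where "b j = (if even j then pt 1 (j/k) else pt 0 (j/k))" for j :: nat
  have setB: "set (B j) = {p\<in>S. \<sigma> p = j}" and distB: "distinct (B j)" for j
    using L by (auto simp: B_def)
  \<comment> \<open>Odd strips are traversed backwards, which preserves the length.\<close>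
  have pathB: "path_length norm (a j # B j @ [b j]) \<le> ?E j + 2 * (\<delta> + 1 / k)" for j
    using L(3)[of j] path_length_rev[of "pt 0 (j/k) # L j @ [pt 1 (j/k)]"]
    by (simp add: a_def b_def B_def)
  define xs where "xs = concat (map B [0..<Suc m])"
  have setxs: "set xs = S" using part by (auto simp: xs_def setB km simp del: upt_Suc)
  have "distinct (concat (map B [0..<l]))" for l
    by (induction l) (auto simp: distB setB)
  then have dist: "distinct xs" by (simp only: xs_def)
  have "xs \<noteq> []" using setxs False by auto
  \<comment> \<open>\<open>b j\<close> and \<open>a (Suc j)\<close> lie on the same side of the
    square, one strip height apart.\<close>
  have link: "norm (a (Suc j) - b j) \<le> 1 / k" for j
    using norm_le_abs_coords[of "a (Suc j) - b j"] by (cases "even j") (simp_all add: a_def b_def flip: diff_divide_distrib)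
  have "TSPD norm ND S \<le> path_length norm (xs @ [hd xs])"
    using TSPD_le_tour_length[OF dist \<open>xs \<noteq> []\<close>] setxs by simp
  also have "\<dots> \<le> path_length norm (a 0 # xs @ [b m]) + norm (b m - a 0)"
    by (rule closed_tour_le) fact
  also have "path_length norm (a 0 # xs @ [b m]) \<le>
    (\<Sum>j\<le>m. path_length norm (a j # B j @ [b j])) + (\<Sum>j<m. norm (a (Suc j) - b j))"
    unfolding xs_def by (rule path_length_concat_le)
  also have "\<dots> \<le> (\<Sum>j\<le>m. ?E j + 2 * (\<delta> + 1 / k)) + (\<Sum>j<m. 1 / k)"
    by (intro add_mono sum_mono pathB link)
  also have "(\<Sum>j\<le>m. ?E j + 2 * (\<delta> + 1 / k)) = (\<Sum>j<k. ?E j) + 2 * (\<delta> + 1 / k) * k"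
    unfolding km by (subst sum.distrib) (simp add: lessThan_Suc_atMost)
  also have "(\<Sum>j<m. 1 / real k) \<le> 1" by (simp add: km)
  also have "norm (b m - a 0) \<le> 2"
  proof -
    have "real m / real k \<le> 1" by (simp add: km)
    then show ?thesis
      using norm_le_abs_coords[of "b m - a 0"] by (cases "even m") (simp_all add: a_def b_def)
  qed
  finally have "TSPD norm ND S \<le> (\<Sum>j<k. ?E j) + 2 * (\<delta> + 1 / k) * k + 1 + 2" by simp
  also have "2 * (\<delta> + 1 / k) * k = 2 * \<delta> * k + 2" using k by (simp add: field_simps)
  finally show ?thesis by simp
qed

section \<open>The uniform distribution on the unit square\<close>

lemma pt_measurable [measurable]:
  assumes [measurable]: "f \<in> borel_measurable M" "g \<in> borel_measurable M"
  shows "(\<lambda>x. pt (f x) (g x)) \<in> borel_measurable M"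
proof -
  have "pt a b = a *\<^sub>R axis 1 1 + b *\<^sub>R axis 2 1" for a b
    by (simp add: vec_eq_iff forall_2 axis_def)
  then show ?thesis by simp
qed

lemma vec_nth_measurable [measurable (raw)]:
  fixes f :: "'a \<Rightarrow> real ^ 'n"
  shows "f \<in> borel_measurable M \<Longrightarrow> (\<lambda>x. f x $ i) \<in> borel_measurable M"
  by (rule measurable_compose[OF _ borel_measurable_nth])

lemma prod_Basis_2: "(\<Prod>b\<in>Basis. (u::point) \<bullet> b) = u $ 1 * u $ 2"
proof -
  have B: "Basis = {axis 1 1 :: point, axis 2 1}"
    by (auto simp: Basis_vec_def UNIV_2)
  have "axis 1 1 \<noteq> (axis 2 1 :: point)" by (simp add: axis_eq_axis)
  then have "(\<Prod>b\<in>{axis 1 1, axis 2 1}. u \<bullet> b) = u $ 1 * u $ 2"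
    by (subst prod.insert) (auto simp: inner_axis)
  then show ?thesis by (simp only: B)
qed

lemma emeasure_lborel_box_2:
  fixes l u :: point
  assumes "l $ 1 \<le> u $ 1" "l $ 2 \<le> u $ 2"
  shows "emeasure lborel (box l u) = ennreal ((u $ 1 - l $ 1) * (u $ 2 - l $ 2))"
    and "emeasure lborel (cbox l u) = ennreal ((u $ 1 - l $ 1) * (u $ 2 - l $ 2))"
proof -
  have "l \<bullet> b \<le> u \<bullet> b" if "b \<in> Basis" for b
    using that assms by (auto simp: Basis_vec_def UNIV_2 inner_axis)
  then show "emeasure lborel (box l u) = ennreal ((u $ 1 - l $ 1) * (u $ 2 - l $ 2))"
    "emeasure lborel (cbox l u) = ennreal ((u $ 1 - l $ 1) * (u $ 2 - l $ 2))"
    by (simp_all add: emeasure_lborel_box emeasure_lborel_cbox prod_Basis_2)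
qed

text \<open>Both measures give a box the product of its side lengths, which characterizes
  \<open>lborel\<close>. This carries Tonelli's theorem over from pairs of reals to
  \<open>real ^ 2\<close>.\<close>

lemma lborel_point:
  "(lborel :: point measure) = distr (lborel \<Otimes>\<^sub>M lborel) borel (\<lambda>(x, y). pt x y)"
proof (rule lborel_eqI)
  fix l u :: point assume le: "\<And>b. b \<in> Basis \<Longrightarrow> l \<bullet> b \<le> u \<bullet> b"
  have le: "l $ 1 \<le> u $ 1" "l $ 2 \<le> u $ 2"
    using le[of "axis 1 1"] le[of "axis 2 1"] by (simp_all add: inner_axis)
  have "(\<lambda>(x, y). pt x y) -` box l u = {l $ 1<..<u $ 1} \<times> {l $ 2<..<u $ 2}"
    by (auto simp: mem_box_cart forall_2)
  then have "emeasure (distr (lborel \<Otimes>\<^sub>M lborel) borel (\<lambda>(x, y). pt x y)) (box l u)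
    = emeasure (lborel \<Otimes>\<^sub>M lborel) ({l $ 1<..<u $ 1} \<times> {l $ 2<..<u $ 2})"
    by (subst emeasure_distr) (auto simp: space_pair_measure)
  also have "\<dots> = ennreal (u $ 1 - l $ 1) * ennreal (u $ 2 - l $ 2)"
    using le by (subst lborel.emeasure_pair_measure_Times) auto
  finally show "emeasure (distr (lborel \<Otimes>\<^sub>M lborel) borel (\<lambda>(x, y). pt x y)) (box l u)
    = (\<Prod>b\<in>Basis. (u - l) \<bullet> b)"
    using le by (simp add: prod_Basis_2 ennreal_mult)
qed simp

abbreviation unit_square_uniform :: "point measure" where
  "unit_square_uniform \<equiv> uniform_measure lborel (cbox 0 1)"

lemma emeasure_unit_square: "emeasure lborel (cbox 0 1 :: point set) = 1"
  by (subst emeasure_lborel_box_2) simp_all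

lemma nn_integral_unit_square:
  assumes [measurable]: "f \<in> borel_measurable borel"
  shows "(\<integral>\<^sup>+p. f p \<partial>unit_square_uniform) =
    (\<integral>\<^sup>+x\<in>{0..1}. (\<integral>\<^sup>+y\<in>{0..1}. f (pt x y) \<partial>lborel) \<partial>lborel)"
proof -
  have "(\<integral>\<^sup>+p. f p \<partial>unit_square_uniform) = (\<integral>\<^sup>+p. f p * indicator (cbox 0 1) p \<partial>lborel)"
    by (subst nn_integral_uniform_measure) (auto simp: emeasure_unit_square divide_ennreal_def)
  also have "\<dots> = (\<integral>\<^sup>+(x, y). f (pt x y) * indicator (cbox 0 1) (pt x y) \<partial>(lborel \<Otimes>\<^sub>M lborel))"
    by (subst lborel_point, subst nn_integral_distr) (auto simp: case_prod_unfold)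
  also have "\<dots> = (\<integral>\<^sup>+x. (\<integral>\<^sup>+y. f (pt x y) * indicator (cbox 0 1) (pt x y) \<partial>lborel) \<partial>lborel)"
    by (subst lborel.nn_integral_fst[symmetric]) auto
  also have "\<dots> = (\<integral>\<^sup>+x. (\<integral>\<^sup>+y. (f (pt x y) * indicator {0..1} y) * indicator {0..1} x \<partial>lborel) \<partial>lborel)"
    by (intro nn_integral_cong) (auto simp: indicator_def mem_box_cart forall_2)
  also have "\<dots> = (\<integral>\<^sup>+x\<in>{0..1}. (\<integral>\<^sup>+y\<in>{0..1}. f (pt x y) \<partial>lborel) \<partial>lborel)"
    by (subst nn_integral_multc) auto
  finally show ?thesis .
qed

lemma prob_space_unit_square: "prob_space unit_square_uniform"
  by (rule prob_space_uniform_measure) (auto simp: emeasure_unit_square)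

lemma cell_borel [measurable]: "cell a b c d \<in> sets borel"
  unfolding cell_def by measurable

lemma emeasure_compl_cell:
  assumes "0 \<le> a" "a \<le> b" "b \<le> 1" "0 \<le> c" "c \<le> d" "d \<le> 1"
  shows "emeasure unit_square_uniform (- cell a b c d) = ennreal (1 - (b - a) * (d - c))"
proof -
  interpret prob_space unit_square_uniform by (rule prob_space_unit_square)
  have "cell a b c d = box (pt a c) (pt b d)"
    by (auto simp: cell_def mem_box_cart forall_2)
  then have "emeasure lborel (cell a b c d) = ennreal ((b - a) * (d - c))"
    using assms by (simp add: emeasure_lborel_box_2)
  moreover have "cbox 0 1 \<inter> cell a b c d = cell a b c d"
    using assms by (auto simp: cell_def mem_box_cart forall_2)
  ultimately have "emeasure unit_square_uniform (cell a b c d) = ennreal ((b - a) * (d - c))"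
    by (simp add: emeasure_uniform_measure emeasure_unit_square divide_ennreal_def)
  then have "prob (cell a b c d) = (b - a) * (d - c)"
    using assms by (simp add: measure_def)
  then show ?thesis
    using prob_compl[of "cell a b c d"] by (simp add: emeasure_eq_measure Compl_eq_Diff_UNIV)
qed

section \<open>Expectations over the independent sample\<close>

text \<open>Stated for indices rather than points, so that its expectation is an integral over a
  product space: once \<open>X i\<close> and \<open>X l\<close> are fixed, the box condition
  concerns only the other coordinates.\<close>

definition edge_term :: "real \<Rightarrow> real \<Rightarrow> nat \<Rightarrow> nat \<Rightarrow> nat \<Rightarrow> (nat \<Rightarrow> point) \<Rightarrow> real" where
  "edge_term c d n i l X = norm (X l - X i) *
     of_bool (X i $ 2 \<in> {c..d} \<and> X l $ 2 \<in> {c..d} \<and> X i $ 1 \<le> X l $ 1 \<and>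
       (\<forall>r\<in>{..<n} - {i, l}. X r \<notin> cell (X i $ 1) (X l $ 1) c d))"

text \<open>The integrand on the right is jointly measurable in \<open>a\<close>, \<open>b\<close>
  and \<open>r\<close>, so the measure of the complement depends measurably on the corners of the
  cell.\<close>

lemma emeasure_compl_cell_eq_nn_integral:
  "emeasure unit_square_uniform (- cell a b c d) =
    (\<integral>\<^sup>+r. of_bool (\<not> (a < r $ 1 \<and> r $ 1 < b \<and> c < r $ 2 \<and> r $ 2 < d)) \<partial>unit_square_uniform)"
proof -
  have "emeasure unit_square_uniform (- cell a b c d) =
      (\<integral>\<^sup>+r. indicator (- cell a b c d) r \<partial>unit_square_uniform)"
    by (rule nn_integral_indicator[symmetric]) simp
  also have "\<dots> = (\<integral>\<^sup>+r. of_bool (\<not> (a < r $ 1 \<and> r $ 1 < b \<and> c < r $ 2 \<and> r $ 2 < d)) \<partial>unit_square_uniform)"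
    by (intro nn_integral_cong) (auto simp: cell_def indicator_def)
  finally show ?thesis .
qed

text \<open>Given \<open>X i = p\<close> and \<open>X l = q\<close>, the remaining
  \<open>n - 2\<close> points avoid the cell independently and with equal probability, hence the
  power. Fubini's theorem splits off the coordinates \<open>i\<close> and \<open>l\<close>, and the
  box condition is a product over the others.\<close>

lemma nn_integral_edge_term:
  assumes "i < n" "l < n" "i \<noteq> l"
  shows "(\<integral>\<^sup>+x. ennreal (edge_term c d n i l x) \<partial>PiM {..<n} (\<lambda>_. unit_square_uniform)) =
    (\<integral>\<^sup>+p. (\<integral>\<^sup>+q. ennreal (norm (q - p)) * of_bool (p $ 2 \<in> {c..d} \<and> q $ 2 \<in> {c..d} \<and> p $ 1 \<le> q $ 1)
       * emeasure unit_square_uniform (- cell (p $ 1) (q $ 1) c d) ^ (n - 2)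
       \<partial>unit_square_uniform) \<partial>unit_square_uniform)"
proof -
  let ?U = unit_square_uniform
  interpret U: prob_space ?U by (rule prob_space_unit_square)
  interpret product_sigma_finite "\<lambda>_::nat. ?U" ..
  define I where "I = {..<n} - {i, l}"
  have I: "{..<n} = insert i (insert l I)" "finite I" "i \<notin> insert l I" "l \<notin> I" "card I = n - 2"
    using assms by (auto simp: I_def card_Diff_subset)
  define g where "g p q = ennreal (norm (q - p)) * of_bool (p $ 2 \<in> {c..d} \<and> q $ 2 \<in> {c..d} \<and> p $ 1 \<le> q $ 1)"
    for p q :: point
  have g[measurable]: "(\<lambda>x. g (f x) (h x)) \<in> borel_measurable N"
    if [measurable]: "f \<in> borel_measurable N" "h \<in> borel_measurable N" for f h and N :: "'x measure"
    unfolding g_def by measurable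
  define e where "e a b r = (of_bool (\<not> (a < r $ 1 \<and> r $ 1 < b \<and> c < r $ 2 \<and> r $ 2 < d)) :: ennreal)"
    for a b and r :: point
  have e[measurable]: "(\<lambda>x. e (f x) (h x) (k x)) \<in> borel_measurable N"
    if [measurable]: "f \<in> borel_measurable N" "h \<in> borel_measurable N" "k \<in> borel_measurable N"
    for f h k and N :: "'x measure"
    unfolding e_def by measurable
  have int_e: "(\<integral>\<^sup>+r. e a b r \<partial>?U) = emeasure ?U (- cell a b c d)" for a b
    unfolding e_def by (rule emeasure_compl_cell_eq_nn_integral[symmetric])
  have e_prod: "(\<Prod>r\<in>I. e a b (x r)) = of_bool (\<forall>r\<in>I. x r \<notin> cell a b c d)" for a b x
    using \<open>finite I\<close> by (induction rule: finite_induct) (auto simp: e_def cell_def)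
  define F where "F x = g (x i) (x l) * (\<Prod>r\<in>I. e (x i $ 1) (x l $ 1) (x r))" for x
  have F: "ennreal (edge_term c d n i l x) = F x" for x
    unfolding edge_term_def F_def e_prod g_def I_def[symmetric] by auto
  have meas[measurable]: "F \<in> borel_measurable (PiM (insert i (insert l I)) (\<lambda>_. ?U))"
    unfolding F_def by measurable
  have "(\<integral>\<^sup>+x. F x \<partial>PiM {..<n} (\<lambda>_. ?U)) =
      (\<integral>\<^sup>+p. (\<integral>\<^sup>+x. F (x(i := p)) \<partial>PiM (insert l I) (\<lambda>_. ?U)) \<partial>?U)"
    unfolding I(1) using I by (intro product_nn_integral_insert_rev) auto
  also have "\<dots> = (\<integral>\<^sup>+p. (\<integral>\<^sup>+q. (\<integral>\<^sup>+x. F (x(l := q, i := p)) \<partial>PiM I (\<lambda>_. ?U)) \<partial>?U) \<partial>?U)"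
    using I by (intro nn_integral_cong product_nn_integral_insert_rev) measurable
  also have "\<dots> = (\<integral>\<^sup>+p. (\<integral>\<^sup>+q. g p q * emeasure ?U (- cell (p $ 1) (q $ 1) c d) ^ (n - 2) \<partial>?U) \<partial>?U)"
  proof (intro nn_integral_cong)
    fix p q :: point
    have "F (x(l := q, i := p)) = g p q * (\<Prod>r\<in>I. e (p $ 1) (q $ 1) (x r))" for x
    proof -
      have "(\<Prod>r\<in>I. e (p $ 1) (q $ 1) ((x(l := q, i := p)) r)) = (\<Prod>r\<in>I. e (p $ 1) (q $ 1) (x r))"
        using I by (intro prod.cong) auto
      then show ?thesis using assms by (simp add: F_def)
    qed
    then have "(\<integral>\<^sup>+x. F (x(l := q, i := p)) \<partial>PiM I (\<lambda>_. ?U)) =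
        g p q * (\<integral>\<^sup>+x. (\<Prod>r\<in>I. e (p $ 1) (q $ 1) (x r)) \<partial>PiM I (\<lambda>_. ?U))"
      by (simp add: nn_integral_cmult)
    also have "(\<integral>\<^sup>+x. (\<Prod>r\<in>I. e (p $ 1) (q $ 1) (x r)) \<partial>PiM I (\<lambda>_. ?U)) =
        emeasure ?U (- cell (p $ 1) (q $ 1) c d) ^ (n - 2)"
      by (subst product_nn_integral_prod) (auto simp: I int_e)
    finally show "(\<integral>\<^sup>+x. F (x(l := q, i := p)) \<partial>PiM I (\<lambda>_. ?U)) =
      g p q * emeasure ?U (- cell (p $ 1) (q $ 1) c d) ^ (n - 2)" .
  qed
  finally show ?thesis by (simp add: F g_def)
qed

lemma nn_integral_avoid_cell:
  assumes "0 \<le> a" "a \<le> b" "b \<le> 1" "0 \<le> c" "c \<le> d" "d \<le> 1"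
  shows "(\<integral>\<^sup>+x. of_bool (\<forall>r<n. x r \<notin> cell a b c d) \<partial>PiM {..<n} (\<lambda>_. unit_square_uniform))
    = ennreal (1 - (b - a) * (d - c)) ^ n"
proof -
  let ?U = unit_square_uniform
  interpret U: prob_space ?U by (rule prob_space_unit_square)
  interpret product_sigma_finite "\<lambda>_::nat. ?U" ..
  have "(of_bool (\<forall>r<n. x r \<notin> cell a b c d) :: ennreal) = (\<Prod>r<n. indicator (- cell a b c d) (x r))" for x
    by (auto simp: indicator_def prod_zero_iff)
  then have "(\<integral>\<^sup>+x. of_bool (\<forall>r<n. x r \<notin> cell a b c d) \<partial>PiM {..<n} (\<lambda>_. ?U)) =
      (\<Prod>r<n. \<integral>\<^sup>+p. indicator (- cell a b c d) p \<partial>?U)"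
    by (simp only:) (rule product_nn_integral_prod; simp)
  also have "(\<integral>\<^sup>+p. indicator (- cell a b c d) p \<partial>?U) = emeasure ?U (- cell a b c d)"
    by (rule nn_integral_indicator) simp
  finally show ?thesis by (simp only: prod_constant card_lessThan emeasure_compl_cell[OF assms])
qed

section \<open>The expected length of an edge\<close>

lemma set_nn_integral_Ici_affine:
  fixes a t :: real
  assumes [measurable]: "f \<in> borel_measurable borel" and a: "a > 0"
  shows "(\<integral>\<^sup>+x\<in>{t..}. f (x - t) \<partial>lborel) = ennreal (1 / a) * (\<integral>\<^sup>+z\<in>{0..}. f (z / a) \<partial>lborel)"
proof -
  have "indicator {t..} (t + 1 / a * z) = (indicator {0..} z :: ennreal)" for z
    using a by (simp add: indicator_def zero_le_divide_iff)
  then show ?thesis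
    using a by (subst nn_integral_real_affine[where c = "1 / a" and t = t]) simp_all
qed

lemma set_nn_integral_Icc_affine:
  fixes c w :: real
  assumes [measurable]: "f \<in> borel_measurable borel" and w: "w > 0"
  shows "(\<integral>\<^sup>+y\<in>{c..c + w}. f y \<partial>lborel) = ennreal w * (\<integral>\<^sup>+u\<in>{0..1}. f (c + w * u) \<partial>lborel)"
proof -
  have "indicator {c..c + w} (c + w * u) = (indicator {0..1} u :: ennreal)" for u
    using w by (simp add: indicator_def zero_le_mult_iff)
  then show ?thesis
    using w by (subst nn_integral_real_affine[where c = w and t = c]) simp_all
qed

text \<open>The integral of the theorem with \<open>H\<close> in place of \<open>h\<^sup>2\<close>.
  As an \<open>ennreal\<close> it can be reordered and compared without integrability conditions;
  \<open>strip_constant_eq_LBINT\<close> returns to real integrals.\<close>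

definition strip_constant :: "real \<Rightarrow> ennreal" where
  "strip_constant H = (\<integral>\<^sup>+z\<in>{0..}. (\<integral>\<^sup>+u1\<in>{0..1}. (\<integral>\<^sup>+u0\<in>{0..1}.
     ennreal (exp (- z) * sqrt (z\<^sup>2 + H\<^sup>2 * (u0 - u1)\<^sup>2)) \<partial>lborel) \<partial>lborel) \<partial>lborel)"

lemma norm_pt: "norm (pt x y) = sqrt (x\<^sup>2 + y\<^sup>2)"
  by (simp add: norm_vec_def L2_set_def sum_2)

text \<open>The power is at most \<open>exp (- (a * s))\<close> with \<open>a = w * N\<close> and
  \<open>s\<close> the horizontal distance. After substituting \<open>z = a * s\<close> and
  rescaling the heights to \<open>u0\<close> and \<open>u1\<close>, the differentials contribute
  \<open>w * w / a\<close> and the edge length another \<open>1 / a\<close>, together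
  \<open>(w / a)\<^sup>2 = 1 / N\<^sup>2\<close>. The height difference is now scaled by
  \<open>a * w = w\<^sup>2 * N\<close>, which the monotonicity of \<open>strip_constant\<close>
  replaces by \<open>H\<close>.\<close>

lemma strip_integral_le:
  fixes c w H :: real and N :: nat
  assumes w: "w > 0" and N: "N > 0" and c: "0 \<le> c" "c + w \<le> 1" and H: "w\<^sup>2 * N \<le> H"
  shows "(\<integral>\<^sup>+p. (\<integral>\<^sup>+q. ennreal (norm (q - p)) * of_bool (p $ 2 \<in> {c..c + w} \<and> q $ 2 \<in> {c..c + w} \<and> p $ 1 \<le> q $ 1)
       * emeasure unit_square_uniform (- cell (p $ 1) (q $ 1) c (c + w)) ^ N
       \<partial>unit_square_uniform) \<partial>unit_square_uniform)
    \<le> ennreal (1 / (real N)\<^sup>2) * strip_constant H"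
proof -
  let ?U = unit_square_uniform
  interpret U: prob_space ?U by (rule prob_space_unit_square)
  define a where "a = w * N"
  have a: "a > 0" using w N by (simp add: a_def)
  define G where "G s t = ennreal (sqrt (s\<^sup>2 + t\<^sup>2) * exp (- (a * s)))" for s t
  have [measurable]: "(\<lambda>x. G (f x) (g x)) \<in> borel_measurable M"
    if [measurable]: "f \<in> borel_measurable M" "g \<in> borel_measurable M" for f g and M :: "'x measure"
    unfolding G_def by measurable
  define E where "E p q = ennreal (norm (q - p)) * of_bool (p $ 2 \<in> {c..c + w} \<and> q $ 2 \<in> {c..c + w} \<and> p $ 1 \<le> q $ 1)
       * emeasure ?U (- cell (p $ 1) (q $ 1) c (c + w)) ^ N" for p q :: point
  have [measurable]: "(\<lambda>x. E (f x) (g x)) \<in> borel_measurable M"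
    if [measurable]: "f \<in> borel_measurable M" "g \<in> borel_measurable M" for f g and M :: "'x measure"
    unfolding E_def emeasure_compl_cell_eq_nn_integral by measurable
  have E_le: "E (pt x y) (pt x' y') \<le> G (x' - x) (y' - y) * indicator {c..c + w} y'
      * indicator {x..} x' * indicator {c..c + w} y"
    if "x \<in> {0..1}" "x' \<in> {0..1}" for x y x' y'
  proof (cases "y \<in> {c..c + w} \<and> y' \<in> {c..c + w} \<and> x \<le> x'")
    case True
    have "1 + - (w * (x' - x)) \<le> exp (- (w * (x' - x)))" by (rule exp_ge_add_one_self)
    then have "ennreal (1 - (x' - x) * w) ^ N \<le> ennreal (exp (- (w * (x' - x)))) ^ N"
      by (intro power_mono ennreal_leI) (auto simp: mult.commute)
    also have "\<dots> = ennreal (exp (- (a * (x' - x))))"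
      by (simp add: ennreal_power a_def mult_ac flip: exp_of_nat_mult)
    finally have le: "ennreal (1 - (x' - x) * w) ^ N \<le> ennreal (exp (- (a * (x' - x))))" .
    \<comment> \<open>Both abscissae lie in \<open>{0..1}\<close>, so the cell is inside the square
      and its probability is its area.\<close>
    have em: "emeasure ?U (- cell x x' c (c + w)) = ennreal (1 - (x' - x) * w)"
      using that True c w by (subst emeasure_compl_cell) auto
    have nm: "norm (pt x' y' - pt x y) = sqrt ((x' - x)\<^sup>2 + (y' - y)\<^sup>2)"
    proof -
      have "pt x' y' - pt x y = pt (x' - x) (y' - y)" by (simp add: vec_eq_iff forall_2)
      then show ?thesis by (simp only: norm_pt)
    qed
    have "E (pt x y) (pt x' y') = ennreal (sqrt ((x' - x)\<^sup>2 + (y' - y)\<^sup>2)) * ennreal (1 - (x' - x) * w) ^ N"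
      using True by (simp add: E_def em nm)
    also have "\<dots> \<le> ennreal (sqrt ((x' - x)\<^sup>2 + (y' - y)\<^sup>2)) * ennreal (exp (- (a * (x' - x))))"
      by (rule mult_left_mono[OF le]) simp
    also have "\<dots> = G (x' - x) (y' - y)" by (simp add: G_def ennreal_mult)
    finally show ?thesis using True by simp
  qed (auto simp: E_def)
  have "(\<integral>\<^sup>+p. (\<integral>\<^sup>+q. E p q \<partial>?U) \<partial>?U) =
     (\<integral>\<^sup>+x\<in>{0..1}. (\<integral>\<^sup>+y\<in>{0..1}. (\<integral>\<^sup>+q. E (pt x y) q \<partial>?U) \<partial>lborel) \<partial>lborel)"
    by (rule nn_integral_unit_square) measurable
  also have "\<dots> = (\<integral>\<^sup>+x\<in>{0..1}. (\<integral>\<^sup>+y\<in>{0..1}. (\<integral>\<^sup>+x'\<in>{0..1}. (\<integral>\<^sup>+y'\<in>{0..1}. E (pt x y) (pt x' y')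
        \<partial>lborel) \<partial>lborel) \<partial>lborel) \<partial>lborel)"
  proof -
    have "(\<integral>\<^sup>+q. E p q \<partial>?U) = (\<integral>\<^sup>+x'\<in>{0..1}. (\<integral>\<^sup>+y'\<in>{0..1}. E p (pt x' y') \<partial>lborel) \<partial>lborel)" for p
      by (rule nn_integral_unit_square) measurable
    then show ?thesis by (simp only:)
  qed
  \<comment> \<open>Letting \<open>x'\<close> run over all of \<open>{x..}\<close> enlarges the
    integral and makes the inner value independent of \<open>x\<close>, so that the integration over
    \<open>x\<close> contributes a factor \<open>1\<close>.\<close>
  also have "\<dots> \<le> (\<integral>\<^sup>+x\<in>{0..1}. (\<integral>\<^sup>+y\<in>{c..c + w}. (\<integral>\<^sup>+x'\<in>{x..}. (\<integral>\<^sup>+y'\<in>{c..c + w}. G (x' - x) (y' - y)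
        \<partial>lborel) \<partial>lborel) \<partial>lborel) \<partial>lborel)" (is "?L \<le> ?R")
  proof -
    have "?L \<le> (\<integral>\<^sup>+x\<in>{0..1}. (\<integral>\<^sup>+y. (\<integral>\<^sup>+x'. (\<integral>\<^sup>+y'. G (x' - x) (y' - y) * indicator {c..c + w} y'
      * indicator {x..} x' * indicator {c..c + w} y \<partial>lborel) \<partial>lborel) \<partial>lborel) \<partial>lborel)"
    proof (rule nn_integral_mono)
      fix x :: real
      show "(\<integral>\<^sup>+y\<in>{0..1}. (\<integral>\<^sup>+x'\<in>{0..1}. (\<integral>\<^sup>+y'\<in>{0..1}. E (pt x y) (pt x' y')
        \<partial>lborel) \<partial>lborel) \<partial>lborel) * indicator {0..1} x \<le>
        (\<integral>\<^sup>+y. (\<integral>\<^sup>+x'. (\<integral>\<^sup>+y'. G (x' - x) (y' - y) * indicator {c..c + w} y'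
      * indicator {x..} x' * indicator {c..c + w} y \<partial>lborel) \<partial>lborel) \<partial>lborel) * indicator {0..1} x"
      proof (cases "x \<in> {0..1}")
        case True
        have ind: "A * indicator S z \<le> B" if "z \<in> S \<Longrightarrow> A \<le> B" for A B :: ennreal and S and z :: real
          using that by (auto simp: indicator_def)
        show ?thesis
          using True by (intro mult_right_mono nn_integral_mono ind E_le) auto
      qed simp
    qed
    also have "\<dots> = ?R"
      by (simp add: nn_integral_multc)
    finally show ?thesis .
  qed
  also have "\<dots> = (\<integral>\<^sup>+x\<in>{0..1::real}. (ennreal ((w / a)\<^sup>2) * (\<integral>\<^sup>+u1\<in>{0..1}. (\<integral>\<^sup>+z\<in>{0..}. (\<integral>\<^sup>+u0\<in>{0..1}.
      ennreal (exp (- z) * sqrt (z\<^sup>2 + (a * w)\<^sup>2 * (u0 - u1)\<^sup>2)) \<partial>lborel) \<partial>lborel) \<partial>lborel)) \<partial>lborel)"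
  proof (intro nn_integral_cong arg_cong2[where f = "(*)"] refl)
    fix x :: real
    have "(\<integral>\<^sup>+y\<in>{c..c + w}. (\<integral>\<^sup>+x'\<in>{x..}. (\<integral>\<^sup>+y'\<in>{c..c + w}. G (x' - x) (y' - y) \<partial>lborel) \<partial>lborel) \<partial>lborel)
      = (\<integral>\<^sup>+y\<in>{c..c + w}. (ennreal (1 / a) * (\<integral>\<^sup>+z\<in>{0..}. (ennreal w * (\<integral>\<^sup>+u0\<in>{0..1}. G (z / a) (c + w * u0 - y)
         \<partial>lborel)) \<partial>lborel)) \<partial>lborel)"
    proof -
      have "(\<integral>\<^sup>+y'\<in>{c..c + w}. G s (y' - y) \<partial>lborel) = ennreal w * (\<integral>\<^sup>+u0\<in>{0..1}. G s (c + w * u0 - y) \<partial>lborel)"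
        for s y by (rule set_nn_integral_Icc_affine[OF _ w]) measurable
      moreover have "(\<integral>\<^sup>+x'\<in>{x..}. (ennreal w * (\<integral>\<^sup>+u0\<in>{0..1}. G (x' - x) (c + w * u0 - y) \<partial>lborel)) \<partial>lborel) =
          ennreal (1 / a) * (\<integral>\<^sup>+z\<in>{0..}. (ennreal w * (\<integral>\<^sup>+u0\<in>{0..1}. G (z / a) (c + w * u0 - y) \<partial>lborel)) \<partial>lborel)"
        for y by (rule set_nn_integral_Ici_affine[OF _ a]) measurable
      ultimately show ?thesis by (simp only:)
    qed
    also have "\<dots> = ennreal w * (\<integral>\<^sup>+u1\<in>{0..1}. (ennreal (1 / a) * (\<integral>\<^sup>+z\<in>{0..}. (ennreal w *
         (\<integral>\<^sup>+u0\<in>{0..1}. G (z / a) (c + w * u0 - (c + w * u1)) \<partial>lborel)) \<partial>lborel)) \<partial>lborel)"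
      by (rule set_nn_integral_Icc_affine[OF _ w]) measurable
    also have "\<dots> = ennreal w * (\<integral>\<^sup>+u1\<in>{0..1}. (ennreal (1 / a) * (\<integral>\<^sup>+z\<in>{0..}. (ennreal w *
         (\<integral>\<^sup>+u0\<in>{0..1}. (ennreal (1 / a) * ennreal (exp (- z) * sqrt (z\<^sup>2 + (a * w)\<^sup>2 * (u0 - u1)\<^sup>2)))
           \<partial>lborel)) \<partial>lborel)) \<partial>lborel)"
    proof -
      have "G (z / a) (c + w * u0 - (c + w * u1)) =
          ennreal (1 / a) * ennreal (exp (- z) * sqrt (z\<^sup>2 + (a * w)\<^sup>2 * (u0 - u1)\<^sup>2))" for z u0 u1
      proof -
        have "(z / a)\<^sup>2 + (c + w * u0 - (c + w * u1))\<^sup>2 = (z\<^sup>2 + (a * w)\<^sup>2 * (u0 - u1)\<^sup>2) / a\<^sup>2"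
          using a by (simp add: field_simps power2_eq_square)
        then have "sqrt ((z / a)\<^sup>2 + (c + w * u0 - (c + w * u1))\<^sup>2) =
            1 / a * sqrt (z\<^sup>2 + (a * w)\<^sup>2 * (u0 - u1)\<^sup>2)"
          using a by (simp add: real_sqrt_divide)
        then have "sqrt ((z / a)\<^sup>2 + (c + w * u0 - (c + w * u1))\<^sup>2) * exp (- (a * (z / a))) =
            1 / a * (exp (- z) * sqrt (z\<^sup>2 + (a * w)\<^sup>2 * (u0 - u1)\<^sup>2))"
          using a by simp
        then show ?thesis
          using a unfolding G_def by (simp only:) (rule ennreal_mult, auto)
      qed
      then show ?thesis by (simp only:)
    qed
    also have "\<dots> = ennreal w * (ennreal (1 / a) * (ennreal w * (ennreal (1 / a) *
       (\<integral>\<^sup>+u1\<in>{0..1}. (\<integral>\<^sup>+z\<in>{0..}. (\<integral>\<^sup>+u0\<in>{0..1}.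
        ennreal (exp (- z) * sqrt (z\<^sup>2 + (a * w)\<^sup>2 * (u0 - u1)\<^sup>2)) \<partial>lborel) \<partial>lborel) \<partial>lborel))))"
      by (simp add: nn_integral_cmult mult.assoc)
    also have "\<dots> = ennreal ((w / a)\<^sup>2) * (\<integral>\<^sup>+u1\<in>{0..1}. (\<integral>\<^sup>+z\<in>{0..}. (\<integral>\<^sup>+u0\<in>{0..1}.
        ennreal (exp (- z) * sqrt (z\<^sup>2 + (a * w)\<^sup>2 * (u0 - u1)\<^sup>2)) \<partial>lborel) \<partial>lborel) \<partial>lborel)"
    proof -
      have "ennreal ((w / a)\<^sup>2) = ennreal w * (ennreal (1 / a) * (ennreal w * ennreal (1 / a)))"
        using w a by (simp add: power2_eq_square flip: ennreal_mult)
      then show ?thesis by (simp only: mult.assoc)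
    qed
    finally show "(\<integral>\<^sup>+y\<in>{c..c + w}. (\<integral>\<^sup>+x'\<in>{x..}. (\<integral>\<^sup>+y'\<in>{c..c + w}. G (x' - x) (y' - y) \<partial>lborel) \<partial>lborel) \<partial>lborel)
      = ennreal ((w / a)\<^sup>2) * (\<integral>\<^sup>+u1\<in>{0..1}. (\<integral>\<^sup>+z\<in>{0..}. (\<integral>\<^sup>+u0\<in>{0..1}.
        ennreal (exp (- z) * sqrt (z\<^sup>2 + (a * w)\<^sup>2 * (u0 - u1)\<^sup>2)) \<partial>lborel) \<partial>lborel) \<partial>lborel)" .
  qed
  also have "\<dots> = ennreal ((w / a)\<^sup>2) * (\<integral>\<^sup>+u1\<in>{0..1}. (\<integral>\<^sup>+z\<in>{0..}. (\<integral>\<^sup>+u0\<in>{0..1}.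
      ennreal (exp (- z) * sqrt (z\<^sup>2 + (a * w)\<^sup>2 * (u0 - u1)\<^sup>2)) \<partial>lborel) \<partial>lborel) \<partial>lborel)"
    by (simp add: nn_integral_cmult)
  also have "ennreal ((w / a)\<^sup>2) = ennreal (1 / (real N)\<^sup>2)"
    using w by (simp add: a_def power_divide power_mult_distrib)
  \<comment> \<open>Tonelli's theorem: \<open>strip_constant\<close> has \<open>z\<close> outermost,
    whereas here the height of the first endpoint is integrated outside the horizontal
    distance.\<close>
  also have "(\<integral>\<^sup>+u1\<in>{0..1}. (\<integral>\<^sup>+z\<in>{0..}. (\<integral>\<^sup>+u0\<in>{0..1}.
      ennreal (exp (- z) * sqrt (z\<^sup>2 + (a * w)\<^sup>2 * (u0 - u1)\<^sup>2)) \<partial>lborel) \<partial>lborel) \<partial>lborel) =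
     strip_constant (a * w)"
  proof -
    have "(\<integral>\<^sup>+u1. (\<integral>\<^sup>+z. (\<integral>\<^sup>+u0. ennreal (exp (- z) * sqrt (z\<^sup>2 + (a * w)\<^sup>2 * (u0 - u1)\<^sup>2)) * indicator {0..1} u0
        * indicator {0..} z * indicator {0..1} u1 \<partial>lborel) \<partial>lborel) \<partial>lborel) =
      (\<integral>\<^sup>+z. (\<integral>\<^sup>+u1. (\<integral>\<^sup>+u0. ennreal (exp (- z) * sqrt (z\<^sup>2 + (a * w)\<^sup>2 * (u0 - u1)\<^sup>2)) * indicator {0..1} u0
        * indicator {0..} z * indicator {0..1} u1 \<partial>lborel) \<partial>lborel) \<partial>lborel)"
      by (rule lborel_pair.Fubini') measurable
    also have "\<dots> = (\<integral>\<^sup>+z. (\<integral>\<^sup>+u1. (\<integral>\<^sup>+u0. ennreal (exp (- z) * sqrt (z\<^sup>2 + (a * w)\<^sup>2 * (u0 - u1)\<^sup>2)) * indicator {0..1} u0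
        * indicator {0..1} u1 * indicator {0..} z \<partial>lborel) \<partial>lborel) \<partial>lborel)"
      by (simp only: mult_ac)
    finally show ?thesis
      by (simp add: strip_constant_def nn_integral_multc)
  qed
  also have "strip_constant (a * w) \<le> strip_constant H"
  proof -
    have "(a * w)\<^sup>2 \<le> H\<^sup>2"
      using H w a by (intro power_mono) (auto simp: a_def power2_eq_square mult_ac)
    then show ?thesis
      unfolding strip_constant_def
      by (intro nn_integral_mono mult_right_mono ennreal_leI mult_left_mono real_sqrt_le_mono
          add_left_mono) auto
  qed
  finally show ?thesis unfolding E_def by (simp add: mult_left_mono)
qed

section \<open>The strip constant\<close>

lemma set_nn_integral_eq_set_lebesgue_integral:
  fixes f :: "'a \<Rightarrow> real"
  assumes [measurable]: "f \<in> borel_measurable M" "A \<in> sets M" and nn: "\<And>x. 0 \<le> f x"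
    and fin: "(\<integral>\<^sup>+x\<in>A. ennreal (f x) \<partial>M) < \<infinity>"
  shows "(\<integral>\<^sup>+x\<in>A. ennreal (f x) \<partial>M) = ennreal (LINT x:A|M. f x)"
proof -
  have eq: "(\<integral>\<^sup>+x\<in>A. ennreal (f x) \<partial>M) = (\<integral>\<^sup>+x. ennreal (indicator A x *\<^sub>R f x) \<partial>M)"
    by (intro nn_integral_cong) (auto simp: indicator_def)
  have "integrable M (\<lambda>x. indicator A x *\<^sub>R f x)"
    using fin nn by (intro integrableI_nonneg) (auto simp: eq)
  then show ?thesis
    unfolding eq set_lebesgue_integral_def using nn by (intro nn_integral_eq_integral) auto
qed

lemma set_nn_integral_unit_interval_le:
  assumes "\<And>u. u \<in> {0..1} \<Longrightarrow> f u \<le> b"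
  shows "(\<integral>\<^sup>+u\<in>{0..1::real}. f u \<partial>lborel) \<le> (b :: ennreal)"
proof -
  have "(\<integral>\<^sup>+u\<in>{0..1::real}. f u \<partial>lborel) \<le> (\<integral>\<^sup>+u. b * indicator {0..1::real} u \<partial>lborel)"
    using assms by (intro nn_integral_mono) (auto simp: indicator_def)
  also have "\<dots> = b" by (simp add: nn_integral_cmult)
  finally show ?thesis .
qed

text \<open>The Gamma integral. It serves with \<open>m = 1\<close> to show that the strip constant
  is finite and with \<open>m = 2\<close> to evaluate its tangent bound.\<close>

lemma set_nn_integral_exp_poly:
  assumes "0 \<le> a" "0 \<le> b"
  shows "(\<integral>\<^sup>+z\<in>{0..}. ennreal (exp (- z) * (a * z ^ m + b)) \<partial>lborel) = ennreal (a * fact m + b)"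
proof -
  have "(\<integral>\<^sup>+z\<in>{0..}. ennreal (exp (- z) * (a * z ^ m + b)) \<partial>lborel) =
      (\<integral>\<^sup>+z. ennreal a * (ennreal (z ^ m * exp (- z)) * indicator {0..} z)
        + ennreal b * (ennreal (z ^ 0 * exp (- z)) * indicator {0..} z) \<partial>lborel)"
    using assms by (intro nn_integral_cong)
      (auto simp: indicator_def algebra_simps simp flip: ennreal_mult ennreal_plus)
  also have "\<dots> = ennreal (a * fact m + b)"
    using assms
    by (simp add: nn_integral_add nn_integral_cmult nn_intergal_power_times_exp_Ici[of m]
        nn_intergal_power_times_exp_Ici[of 0, simplified] ennreal_mult)
  finally show ?thesis .
qed

text \<open>A real integral is \<open>0\<close> by default where integrability fails, so finiteness
  is needed at each of the three levels. The function \<open>bd\<close> dominates the integrand and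
  both inner integrals and has a finite integral over \<open>z \<ge> 0\<close>.\<close>

lemma strip_constant_eq_LBINT:
  fixes H :: real
  defines "L \<equiv> LBINT z:{0..}. LBINT u1:{0..1}. LBINT u0:{0..1}.
     exp (- z) * sqrt (z\<^sup>2 + H\<^sup>2 * (u0 - u1)\<^sup>2)"
  assumes H: "0 \<le> H"
  shows "strip_constant H = ennreal L" "0 \<le> L"
proof -
  define f where "f z u1 u0 = exp (- z) * sqrt (z\<^sup>2 + H\<^sup>2 * (u0 - u1)\<^sup>2)" for z u1 u0 :: real
  have [measurable]: "(\<lambda>x. f (a x) (b x) (c x)) \<in> borel_measurable M"
    if [measurable]: "a \<in> borel_measurable M" "b \<in> borel_measurable M" "c \<in> borel_measurable M"
    for a b c and M :: "'x measure"
    unfolding f_def by measurable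
  define g where "g z u1 = (LBINT u0:{0..1}. f z u1 u0)" for z u1
  have [measurable]: "(\<lambda>x. g (a x) (b x)) \<in> borel_measurable M"
    if [measurable]: "a \<in> borel_measurable M" "b \<in> borel_measurable M" for a b and M :: "'x measure"
    unfolding g_def set_lebesgue_integral_def by measurable
  define k where "k z = (LBINT u1:{0..1}. g z u1)" for z
  have [measurable]: "k \<in> borel_measurable borel"
    unfolding k_def set_lebesgue_integral_def by measurable
  have f0: "0 \<le> f z u1 u0" for z u1 u0 by (simp add: f_def)
  have g0: "0 \<le> g z u1" for z u1
    unfolding g_def set_lebesgue_integral_def using f0 by (intro Bochner_Integration.integral_nonneg) auto
  have k0: "0 \<le> k z" for z
    unfolding k_def set_lebesgue_integral_def using g0 by (intro Bochner_Integration.integral_nonneg) auto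
  define bd where "bd z = exp (- z) * (\<bar>z\<bar> + H)" for z
  have f_le: "f z u1 u0 \<le> bd z" if "u0 \<in> {0..1}" "u1 \<in> {0..1}" for z u0 u1
  proof -
    have "sqrt (z\<^sup>2 + H\<^sup>2 * (u0 - u1)\<^sup>2) \<le> \<bar>z\<bar> + \<bar>H * (u0 - u1)\<bar>"
      using sqrt_sum_squares_le_sum_abs[of z "H * (u0 - u1)"] by (simp add: power_mult_distrib)
    also have "\<bar>H * (u0 - u1)\<bar> \<le> H"
      using that H mult_left_mono[of "\<bar>u0 - u1\<bar>" 1 H] by (auto simp: abs_mult)
    finally show ?thesis by (simp add: f_def bd_def mult_left_mono)
  qed
  have g: "(\<integral>\<^sup>+u0\<in>{0..1}. ennreal (f z u1 u0) \<partial>lborel) = ennreal (g z u1)"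
    if "u1 \<in> {0..1}" for z u1
  proof -
    have "(\<integral>\<^sup>+u0\<in>{0..1}. ennreal (f z u1 u0) \<partial>lborel) \<le> ennreal (bd z)"
      using f_le that by (intro set_nn_integral_unit_interval_le ennreal_leI) auto
    then show ?thesis
      unfolding g_def using f0
      by (intro set_nn_integral_eq_set_lebesgue_integral) (auto simp: le_less_trans)
  qed
  have g_le: "ennreal (g z u1) \<le> ennreal (bd z)" if "u1 \<in> {0..1}" for z u1
    unfolding g[OF that, symmetric]
    using f_le that by (intro set_nn_integral_unit_interval_le ennreal_leI) auto
  have k: "(\<integral>\<^sup>+u1\<in>{0..1}. ennreal (g z u1) \<partial>lborel) = ennreal (k z)"
    and k_le: "ennreal (k z) \<le> ennreal (bd z)" for z
  proof -
    have le: "(\<integral>\<^sup>+u1\<in>{0..1}. ennreal (g z u1) \<partial>lborel) \<le> ennreal (bd z)"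
      using g_le by (intro set_nn_integral_unit_interval_le) auto
    then show eq: "(\<integral>\<^sup>+u1\<in>{0..1}. ennreal (g z u1) \<partial>lborel) = ennreal (k z)"
      unfolding k_def using g0
      by (intro set_nn_integral_eq_set_lebesgue_integral) (auto simp: le_less_trans)
    show "ennreal (k z) \<le> ennreal (bd z)" using le eq by simp
  qed
  have "(\<integral>\<^sup>+z\<in>{0..}. ennreal (k z) \<partial>lborel) \<le> (\<integral>\<^sup>+z\<in>{0..}. ennreal (exp (- z) * (1 * z ^ 1 + H)) \<partial>lborel)"
  proof (rule nn_integral_mono)
    fix z :: real
    show "ennreal (k z) * indicator {0..} z \<le> ennreal (exp (- z) * (1 * z ^ 1 + H)) * indicator {0..} z"
      using k_le[of z] by (cases "0 \<le> z") (simp_all add: bd_def)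
  qed
  also have "\<dots> < \<infinity>" using H by (subst set_nn_integral_exp_poly) auto
  finally have "(\<integral>\<^sup>+z\<in>{0..}. ennreal (k z) \<partial>lborel) = ennreal (LBINT z:{0..}. k z)"
    using k0 by (intro set_nn_integral_eq_set_lebesgue_integral) auto
  moreover have "strip_constant H = (\<integral>\<^sup>+z\<in>{0..}. ennreal (k z) \<partial>lborel)"
  proof -
    have "(\<integral>\<^sup>+u0\<in>{0..1}. ennreal (f z u1 u0) \<partial>lborel) * indicator {0..1} u1 = ennreal (g z u1) * indicator {0..1} u1"
      for z u1 by (cases "u1 \<in> {0..1}") (simp_all add: g)
    then show ?thesis unfolding strip_constant_def f_def[symmetric] by (simp only: k)
  qed
  moreover have "L = (LBINT z:{0..}. k z)" by (simp add: L_def k_def g_def f_def)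
  moreover have "0 \<le> (LBINT z:{0..}. k z)"
    unfolding set_lebesgue_integral_def using k0 by (intro Bochner_Integration.integral_nonneg) auto
  ultimately show "strip_constant H = ennreal L" "0 \<le> L" by simp_all
qed

text \<open>By concavity the square root lies below its tangent, after which the integrals are
  elementary. Under the weights \<open>z\<^sup>2\<close> has mean \<open>2\<close> and
  \<open>(u0 - u1)\<^sup>2\<close> has mean \<open>1 / 6\<close>, so the argument of the root has
  mean \<open>2 + 12 / 6 = 4\<close>, and the bound is \<open>sqrt 4\<close>.\<close>

lemma strip_constant_sqrt_12: "strip_constant (sqrt 12) \<le> 2"
proof -
  have le: "exp (- z) * sqrt (z\<^sup>2 + (sqrt 12)\<^sup>2 * (u0 - u1)\<^sup>2) \<le>
      exp (- z) * (z\<^sup>2 / 4 + 1 + 3 * (u0 - u1)\<^sup>2)" for z u0 u1 :: real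
  proof -
    \<comment> \<open>The tangent to the square root at \<open>4\<close>, the mean of \<open>A\<close> under the three integrals.\<close>
    define A where "A = z\<^sup>2 + 12 * (u0 - u1)\<^sup>2"
    have "0 \<le> A" by (simp add: A_def)
    have "0 \<le> (sqrt A / 2 - 1)\<^sup>2" by simp
    also have "\<dots> = A / 4 + 1 - sqrt A" using \<open>0 \<le> A\<close> by (simp add: power2_diff power_divide)
    finally have "sqrt A \<le> A / 4 + 1" by simp
    also have "A / 4 + 1 = z\<^sup>2 / 4 + 1 + 3 * (u0 - u1)\<^sup>2" by (simp add: A_def)
    finally have "sqrt A \<le> z\<^sup>2 / 4 + 1 + 3 * (u0 - u1)\<^sup>2" .
    then show ?thesis by (simp add: A_def mult_left_mono)
  qed
  have int0: "(\<integral>\<^sup>+u0\<in>{0..1}. ennreal (exp (- z) * (z\<^sup>2 / 4 + 1 + 3 * (u0 - u1)\<^sup>2)) \<partial>lborel)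
     = ennreal (exp (- z) * (z\<^sup>2 / 4 + 2 - 3 * u1 + 3 * u1\<^sup>2))" for z u1 :: real
  proof -
    have "(\<integral>\<^sup>+u0\<in>{0..1}. ennreal (exp (- z) * (z\<^sup>2 / 4 + 1 + 3 * (u0 - u1)\<^sup>2)) \<partial>lborel)
       = ennreal (exp (- z) * ((z\<^sup>2 / 4 + 1) * 1 + (1 - u1) ^ 3) - exp (- z) * ((z\<^sup>2 / 4 + 1) * 0 + (0 - u1) ^ 3))"
      by (rule nn_integral_FTC_Icc) (auto intro!: derivative_eq_intros simp: algebra_simps)
    also have "exp (- z) * ((z\<^sup>2 / 4 + 1) * 1 + (1 - u1) ^ 3) - exp (- z) * ((z\<^sup>2 / 4 + 1) * 0 + (0 - u1) ^ 3)
      = exp (- z) * (z\<^sup>2 / 4 + 2 - 3 * u1 + 3 * u1\<^sup>2)"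
      by (simp add: algebra_simps power2_eq_square power3_eq_cube)
    finally show ?thesis .
  qed
  have int1: "(\<integral>\<^sup>+u1\<in>{0..1}. ennreal (exp (- z) * (z\<^sup>2 / 4 + 2 - 3 * u1 + 3 * u1\<^sup>2)) \<partial>lborel)
     = ennreal (exp (- z) * (1 / 4 * z\<^sup>2 + 3 / 2))" for z :: real
  proof -
    \<comment> \<open>\<open>nn_integral_FTC_Icc\<close> asks for a nonnegative integrand; unlike in
      the previous integral, the square has to be completed to see this.\<close>
    have nn: "0 \<le> z\<^sup>2 / 4 + 2 - 3 * u + 3 * u\<^sup>2" for u :: real
    proof -
      have "z\<^sup>2 / 4 + 2 - 3 * u + 3 * u\<^sup>2 = (z / 2)\<^sup>2 + 3 * (u - 1 / 2)\<^sup>2 + 5 / 4"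
        by (simp add: power2_eq_square field_simps)
      then show ?thesis by (simp only:) simp
    qed
    have "(\<integral>\<^sup>+u1\<in>{0..1}. ennreal (exp (- z) * (z\<^sup>2 / 4 + 2 - 3 * u1 + 3 * u1\<^sup>2)) \<partial>lborel)
       = ennreal (exp (- z) * ((z\<^sup>2 / 4 + 2) * 1 - 3 / 2 * 1\<^sup>2 + 1 ^ 3) - exp (- z) * ((z\<^sup>2 / 4 + 2) * 0 - 3 / 2 * 0\<^sup>2 + 0 ^ 3))"
    proof (rule nn_integral_FTC_Icc)
      show "0 \<le> exp (- z) * (z\<^sup>2 / 4 + 2 - 3 * u + 3 * u\<^sup>2)" for u
        using nn[of u] by (intro mult_nonneg_nonneg) auto
    qed (auto intro!: derivative_eq_intros simp: algebra_simps)
    also have "exp (- z) * ((z\<^sup>2 / 4 + 2) * 1 - 3 / 2 * 1\<^sup>2 + 1 ^ 3) - exp (- z) * ((z\<^sup>2 / 4 + 2) * 0 - 3 / 2 * 0\<^sup>2 + 0 ^ 3)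
      = exp (- z) * (1 / 4 * z\<^sup>2 + 3 / 2)"
      by (simp add: algebra_simps)
    finally show ?thesis .
  qed
  have "strip_constant (sqrt 12) \<le> (\<integral>\<^sup>+z\<in>{0..}. (\<integral>\<^sup>+u1\<in>{0..1}. (\<integral>\<^sup>+u0\<in>{0..1}.
     ennreal (exp (- z) * (z\<^sup>2 / 4 + 1 + 3 * (u0 - u1)\<^sup>2)) \<partial>lborel) \<partial>lborel) \<partial>lborel)"
    unfolding strip_constant_def by (intro nn_integral_mono mult_right_mono ennreal_leI le) auto
  also have "\<dots> = ennreal (1 / 4 * fact 2 + 3 / 2)"
    unfolding int0 int1 by (rule set_nn_integral_exp_poly) simp_all
  also have "\<dots> = 2" by simp
  finally show ?thesis .
qed

section \<open>The expected length of the strip tour\<close>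

lemma edge_term_nonneg: "0 \<le> edge_term c d n i l X"
  by (simp add: edge_term_def)

text \<open>Sample points may coincide, so \<open>g\<close> picks one index for each point of
  \<open>S\<close>; successor pairs then correspond injectively to pairs of distinct indices. By
  \<open>cell\<close>, a sample point in the box between two successors would belong to
  \<open>S\<close> and separate them, so the box is empty and the edge term is the full length. The
  other edge terms are nonnegative.\<close>

lemma sum_successor_pairs_le_edge_terms:
  fixes X :: "nat \<Rightarrow> point"
  assumes S: "S \<subseteq> X ` {..<n}" "\<And>p. p \<in> S \<Longrightarrow> p $ 2 \<in> {c..d}"
    and cell: "\<And>r. r < n \<Longrightarrow> c < X r $ 2 \<Longrightarrow> X r $ 2 < d \<Longrightarrow> X r \<in> S"
  shows "(\<Sum>(p, q)\<in>successor_pairs S. norm (q - p)) \<le>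
    (\<Sum>i<n. \<Sum>l\<in>{..<n} - {i}. edge_term c d n i l X)"
proof -
  have "\<forall>p\<in>S. \<exists>i<n. X i = p" using S(1) by force
  then obtain g where g: "\<And>p. p \<in> S \<Longrightarrow> g p < n" "\<And>p. p \<in> S \<Longrightarrow> X (g p) = p" by metis
  define h where "h u = (g (fst u), g (snd u))" for u
  have inS: "fst u \<in> S" "snd u \<in> S" "fst u \<noteq> snd u" if "u \<in> successor_pairs S" for u
    using that by (auto simp: successor_pairs_def)
  have inj: "inj_on h (successor_pairs S)"
  proof (rule inj_onI)
    fix u v assume u: "u \<in> successor_pairs S" and v: "v \<in> successor_pairs S" and "h u = h v"
    then have "X (g (fst u)) = X (g (fst v))" "X (g (snd u)) = X (g (snd v))"
      by (simp_all add: h_def)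
    then show "u = v" by (simp add: g(2) inS[OF u] inS[OF v] prod_eq_iff)
  qed
  have sub: "h ` successor_pairs S \<subseteq> Sigma {..<n} (\<lambda>i. {..<n} - {i})"
  proof (rule image_subsetI)
    fix u assume u: "u \<in> successor_pairs S"
    have "g (fst u) \<noteq> g (snd u)"
      using g(2)[OF inS(1)[OF u]] g(2)[OF inS(2)[OF u]] inS(3)[OF u] by metis
    then show "h u \<in> Sigma {..<n} (\<lambda>i. {..<n} - {i})"
      using g(1)[OF inS(1)[OF u]] g(1)[OF inS(2)[OF u]] by (simp add: h_def)
  qed
  have eq: "norm (q - p) = edge_term c d n (g p) (g q) X" if pq: "(p, q) \<in> successor_pairs S" for p q
  proof -
    have "X r \<notin> cell (p $ 1) (q $ 1) c d" if "r < n" for r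
      using cell[OF that] pq by (auto simp: successor_pairs_def cell_def)
    then show ?thesis
      using inS[OF pq, simplified] pq g(2)[of p] g(2)[of q] S(2)[of p] S(2)[of q]
      by (simp add: edge_term_def successor_pairs_def)
  qed
  have "(\<Sum>(p, q)\<in>successor_pairs S. norm (q - p)) =
      (\<Sum>(i, l)\<in>h ` successor_pairs S. edge_term c d n i l X)"
    by (subst sum.reindex[OF inj]) (auto intro!: sum.cong simp: eq h_def)
  also have "\<dots> \<le> (\<Sum>(i, l)\<in>Sigma {..<n} (\<lambda>i. {..<n} - {i}). edge_term c d n i l X)"
    by (rule sum_mono2) (use sub edge_term_nonneg in auto)
  also have "\<dots> = (\<Sum>i<n. \<Sum>l\<in>{..<n} - {i}. edge_term c d n i l X)"
    by (rule sum.Sigma[symmetric]) auto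
  finally show ?thesis .
qed

text \<open>
  Neither \<open>edge_term\<close> nor \<open>strip_functional\<close> sorts the points: each term only asks whether some of the
  sample points lie in a box, so its expectation is a product over independent points.
\<close>

definition strip_functional :: "nat \<Rightarrow> real \<Rightarrow> nat \<Rightarrow> (nat \<Rightarrow> point) \<Rightarrow> real" where
  "strip_functional k \<delta> n X = (\<Sum>j<k. (\<Sum>i<n. \<Sum>l\<in>{..<n} - {i}. edge_term (real j/k) (real j/k + 1/k) n i l X)
     + of_bool (\<forall>r<n. X r \<notin> cell 0 \<delta> (real j/k) (real j/k + 1/k))
     + of_bool (\<forall>r<n. X r \<notin> cell (1 - \<delta>) 1 (real j/k) (real j/k + 1/k))) + 2 * \<delta> * k + 5"

lemma TSPD_le_strip_functional:
  assumes sq: "\<And>i. i < n \<Longrightarrow> X i \<in> cbox 0 1" and k: "k > 0" and \<delta>: "\<delta> \<ge> 0"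
  shows "TSPD norm ND (X ` {..<n}) \<le> strip_functional k \<delta> n X"
proof -
  define S where "S = X ` {..<n}"
  \<comment> \<open>The minimum matters only at height \<open>1\<close>, where the floor is
    \<open>k\<close>; that border belongs to the top strip.\<close>
  define \<sigma> where "\<sigma> p = min (k - 1) (nat \<lfloor>k * p $ 2\<rfloor>)" for p :: point
  have coords: "0 \<le> p $ 1" "p $ 1 \<le> 1" "0 \<le> p $ 2" "p $ 2 \<le> 1" if "p \<in> S" for p
    using that sq by (auto simp: S_def mem_box_cart)
  have \<sigma>k: "\<sigma> p < k" for p using k by (simp add: \<sigma>_def)
  have bounds: "\<sigma> p / k \<le> p $ 2 \<and> p $ 2 \<le> \<sigma> p / k + 1 / k" if "p \<in> S" for p
  proof -
    define m where "m = nat \<lfloor>k * p $ 2\<rfloor>"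
    have "0 \<le> k * p $ 2" using coords[OF that] by simp
    then have m: "m \<le> k * p $ 2" "k * p $ 2 < m + 1" unfolding m_def by linarith+
    have "k * p $ 2 \<le> k" using coords[OF that] by (simp add: mult_left_le)
    have \<sigma>: "\<sigma> p = min (k - 1) m" by (simp only: \<sigma>_def m_def)
    have "\<sigma> p \<le> k * p $ 2" using m(1) by (simp add: \<sigma>)
    moreover have "k * p $ 2 \<le> \<sigma> p + 1"
    proof (cases "m \<le> k - 1")
      case True
      then have "\<sigma> p = m" by (simp add: \<sigma>)
      then show ?thesis using m(2) by simp
    next
      case False
      then have "\<sigma> p = k - 1" by (simp add: \<sigma>)
      then have "\<sigma> p + 1 = k" using k by simp
      then have "real (\<sigma> p) + 1 = k" by linarith
      then show ?thesis using \<open>k * p $ 2 \<le> k\<close> by linarith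
    qed
    ultimately show ?thesis using k by (simp add: field_simps)
  qed
  \<comment> \<open>In the interior of a strip, the floor determines the strip without
    ambiguity.\<close>
  have \<sigma>_cell: "\<sigma> p = j" if "j / k < p $ 2" "p $ 2 < j / k + 1 / k" "j < k" for p and j :: nat
  proof -
    have "j < k * p $ 2" "k * p $ 2 < j + 1" using that k by (simp_all add: field_simps)
    then have "nat \<lfloor>k * p $ 2\<rfloor> = j" by linarith
    then show ?thesis using that by (simp add: \<sigma>_def)
  qed
  have "TSPD norm ND S \<le>
     (\<Sum>j<k. (\<Sum>(p, q)\<in>successor_pairs {p\<in>S. \<sigma> p = j}. norm (q - p))
       + of_bool (\<forall>p\<in>S. \<sigma> p = j \<longrightarrow> \<delta> < p $ 1)
       + of_bool (\<forall>p\<in>S. \<sigma> p = j \<longrightarrow> p $ 1 < 1 - \<delta>)) + 2 * \<delta> * k + 5"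
    using bounds coords \<sigma>k k \<delta>
    by (intro TSPD_le_strip_sum) (auto simp: S_def add_divide_distrib add.commute)
  also have "\<dots> \<le> strip_functional k \<delta> n X"
    unfolding strip_functional_def
  proof (intro add_mono sum_mono order.refl)
    fix j assume "j \<in> {..<k}"
    then have j: "j < k" by simp
    show "(\<Sum>(p, q)\<in>successor_pairs {p\<in>S. \<sigma> p = j}. norm (q - p))
      \<le> (\<Sum>i<n. \<Sum>l\<in>{..<n} - {i}. edge_term (real j/k) (real j/k + 1/k) n i l X)"
    proof (rule sum_successor_pairs_le_edge_terms)
      show "p $ 2 \<in> {real j/k..real j/k + 1/k}" if "p \<in> {p\<in>S. \<sigma> p = j}" for p
        using bounds[of p] that by auto
      show "X r \<in> {p\<in>S. \<sigma> p = j}" if "r < n" "real j/k < X r $ 2" "X r $ 2 < real j/k + 1/k" for r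
        using \<sigma>_cell[OF that(2,3) j] that(1) by (simp add: S_def)
    qed (auto simp: S_def)
    \<comment> \<open>Translates a condition on the points assigned to strip \<open>j\<close> into
      one on all sample points: a sample point in the open cell is assigned to
      \<open>j\<close>.\<close>
    have avoid: "X r \<notin> cell a b (real j/k) (real j/k + 1/k)"
      if "\<forall>p\<in>S. \<sigma> p = j \<longrightarrow> \<not> (a < p $ 1 \<and> p $ 1 < b)" "r < n" for a b r
    proof
      assume "X r \<in> cell a b (real j/k) (real j/k + 1/k)"
      then have *: "a < X r $ 1" "X r $ 1 < b" "real j/k < X r $ 2" "X r $ 2 < real j/k + 1/k"
        by (simp_all add: cell_def)
      then show False using \<sigma>_cell[OF *(3,4) j] that by (auto simp: S_def)
    qed
    show "(of_bool (\<forall>p\<in>S. \<sigma> p = j \<longrightarrow> \<delta> < p $ 1) :: real) \<le>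
        of_bool (\<forall>r<n. X r \<notin> cell 0 \<delta> (real j/k) (real j/k + 1/k))"
      using avoid[of 0 \<delta>] by (simp only: of_bool_less_eq_iff) (meson less_asym)
    show "(of_bool (\<forall>p\<in>S. \<sigma> p = j \<longrightarrow> p $ 1 < 1 - \<delta>) :: real) \<le>
        of_bool (\<forall>r<n. X r \<notin> cell (1 - \<delta>) 1 (real j/k) (real j/k + 1/k))"
      using avoid[of "1 - \<delta>" 1] by (simp only: of_bool_less_eq_iff) (meson less_asym)
  qed
  finally show ?thesis by (simp add: S_def)
qed

section \<open>Measurability and expectation of the strip functional\<close>

lemma edge_term_measurable [measurable]:
  assumes "i < n" "l < n"
  shows "edge_term c d n i l \<in> borel_measurable (PiM {..<n} (\<lambda>_. borel))"
proof -
  let ?P = "PiM {..<n} (\<lambda>_. borel :: point measure)"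
  have strip: "Measurable.pred N (\<lambda>x. f x $ 2 \<in> {c..d} \<and> g x $ 2 \<in> {c..d} \<and> f x $ 1 \<le> g x $ 1)"
    and dist: "(\<lambda>x. norm (g x - f x)) \<in> borel_measurable N"
    and cell: "Measurable.pred N (\<lambda>x. h x \<notin> cell (f x $ 1) (g x $ 1) c d)"
    if [measurable]: "f \<in> borel_measurable N" "g \<in> borel_measurable N" "h \<in> borel_measurable N"
    for f g h and N :: "'x measure"
    unfolding cell_def mem_Collect_eq by measurable
  have m: "(\<lambda>x. x r) \<in> borel_measurable ?P" if "r < n" for r
    by (rule measurable_component_singleton) (simp add: that)
  have "Measurable.pred ?P (\<lambda>x. \<forall>r\<in>{..<n} - {i, l}. x r \<notin> cell (x i $ 1) (x l $ 1) c d)"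
    using assms by (intro pred_intros_finite(3) cell m) auto
  moreover have "Measurable.pred ?P (\<lambda>x. x i $ 2 \<in> {c..d} \<and> x l $ 2 \<in> {c..d} \<and> x i $ 1 \<le> x l $ 1)"
    by (rule strip[OF m m m]) (use assms in \<open>auto intro: m\<close>)
  moreover have "(\<lambda>x. norm (x l - x i)) \<in> borel_measurable ?P"
    by (rule dist[OF m m m]) (use assms in auto)
  ultimately have "(\<lambda>x. norm (x l - x i) * (of_bool (x i $ 2 \<in> {c..d} \<and> x l $ 2 \<in> {c..d} \<and> x i $ 1 \<le> x l $ 1)
      * of_bool (\<forall>r\<in>{..<n} - {i, l}. x r \<notin> cell (x i $ 1) (x l $ 1) c d))) \<in> borel_measurable ?P"
    by (intro borel_measurable_times measurable_compose[OF _ measurable_of_bool]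
        measurable_compose[where g = of_bool and N = "count_space UNIV"]) auto
  then show ?thesis
    by (rule measurable_cong[THEN iffD1, rotated]) (simp add: edge_term_def)
qed

lemma ennreal_of_bool: "ennreal (of_bool Q) = of_bool Q"
  by simp

lemma avoid_cell_measurable [measurable]:
  fixes n :: nat
  shows
  "Measurable.pred (PiM {..<n} (\<lambda>_. borel)) (\<lambda>x. \<forall>r<n. x r \<notin> cell a b c d)"
proof -
  have [measurable]: "(\<lambda>x. x r) \<in> borel_measurable (PiM {..<n} (\<lambda>_. borel :: point measure))" if "r < n" for r
    by (rule measurable_component_singleton) (simp add: that)
  have "Measurable.pred (PiM {..<n} (\<lambda>_. borel)) (\<lambda>x. \<forall>r\<in>{..<n}. x r \<notin> cell a b c d)"
    unfolding cell_def by (intro pred_intros_finite(3)) simp_all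
  then show ?thesis by simp
qed

text \<open>Each of the \<open>k\<close> strips has \<open>n * (n - 1)\<close> ordered index pairs,
  and \<open>strip_integral_le\<close> with \<open>w = 1 / k\<close> and \<open>N = n - 2\<close>
  bounds each expectation by \<open>K / (n - 2)\<^sup>2\<close>. The two end boxes of a strip have
  area \<open>\<delta> / k\<close>, so each is empty with probability
  \<open>(1 - \<delta> / k) ^ n\<close>, at most \<open>exp (- (n * \<delta> / k))\<close>.\<close>

lemma nn_integral_strip_functional_le:
  assumes n: "n > 2" and k: "k > 0" and \<delta>: "0 \<le> \<delta>" "\<delta> \<le> 1" and H: "real (n - 2) / k\<^sup>2 \<le> H"
    and K: "strip_constant H = ennreal K" "0 \<le> K"
  shows "(\<integral>\<^sup>+x. ennreal (strip_functional k \<delta> n x) \<partial>PiM {..<n} (\<lambda>_. unit_square_uniform)) \<le>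
    ennreal (k * (real n * (real n - 1) / (real n - 2)\<^sup>2 * K + 2 * exp (- (n * \<delta> / k))) + 2 * \<delta> * k + 5)"
proof -
  let ?P = "PiM {..<n} (\<lambda>_. unit_square_uniform)"
  interpret U: prob_space unit_square_uniform by (rule prob_space_unit_square)
  interpret P: prob_space ?P by (intro prob_space_PiM prob_space_unit_square)
  have sets[measurable_cong]: "sets ?P = sets (PiM {..<n} (\<lambda>_. borel :: point measure))"
    by (intro sets_PiM_cong) auto
  have em[measurable]: "edge_term c d n i l \<in> borel_measurable ?P" if "i < n" "l < n" for c d i l
    using edge_term_measurable[OF that, of c d] by (simp add: measurable_cong_sets[OF sets refl])
  have pm[measurable]: "Measurable.pred ?P (\<lambda>x. \<forall>r<n. x r \<notin> cell a b c d)" for a b c d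
    using avoid_cell_measurable[of n a b c d] by (simp add: measurable_cong_sets[OF sets refl])
  have ck: "0 \<le> real j / k" "real j / k + 1 / k \<le> 1" if "j < k" for j
    using that by (simp_all add: field_simps)
  define A where "A = K / (real n - 2)\<^sup>2"
  define B where "B = exp (- (n * \<delta> / k))"
  have nonneg: "0 \<le> A" "0 \<le> B" using K by (simp_all add: A_def B_def)
  have edge: "(\<integral>\<^sup>+x. ennreal (edge_term (real j/k) (real j/k + 1/k) n i l x) \<partial>?P) \<le> ennreal A"
    if "j < k" "i < n" "l < n" "i \<noteq> l" for i j l
  proof -
    have "(\<integral>\<^sup>+x. ennreal (edge_term (real j/k) (real j/k + 1/k) n i l x) \<partial>?P)
      \<le> ennreal (1 / (real (n - 2))\<^sup>2) * strip_constant H"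
      unfolding nn_integral_edge_term[OF that(2-4)]
      using k n H ck[OF that(1)]
      by (intro strip_integral_le) (auto simp: power_divide)
    also have "\<dots> = ennreal A"
      using n K by (simp add: A_def of_nat_diff flip: ennreal_mult)
    finally show ?thesis .
  qed
  have avoid: "(\<integral>\<^sup>+x. of_bool (\<forall>r<n. x r \<notin> cell a b (real j/k) (real j/k + 1/k)) \<partial>?P) \<le> ennreal B"
    if "j < k" "0 \<le> a" "b \<le> 1" "b - a = \<delta>" for a b j
  proof -
    have "(\<integral>\<^sup>+x. of_bool (\<forall>r<n. x r \<notin> cell a b (real j/k) (real j/k + 1/k)) \<partial>?P)
      = ennreal (1 - (b - a) * (real j/k + 1/k - real j/k)) ^ n"
      using that \<delta> ck[OF that(1)] by (intro nn_integral_avoid_cell) auto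
    also have "\<dots> \<le> ennreal (exp (- (\<delta> / k))) ^ n"
      using that(4) exp_ge_add_one_self[of "- (\<delta> / k)"]
      by (intro power_mono ennreal_leI) auto
    also have "\<dots> = ennreal B"
      by (simp add: B_def ennreal_power flip: exp_of_nat_mult)
    finally show ?thesis .
  qed
  define e where "e j i l x = ennreal (edge_term (real j/k) (real j/k + 1/k) n i l x)" for j i l x
  define b where "b j x = ennreal (of_bool (\<forall>r<n. x r \<notin> cell 0 \<delta> (real j/k) (real j/k + 1/k)))" for j x
  define b' where "b' j x = ennreal (of_bool (\<forall>r<n. x r \<notin> cell (1 - \<delta>) 1 (real j/k) (real j/k + 1/k)))" for j x
  have meas_e: "e j i l \<in> borel_measurable ?P" if "i < n" "l < n" for j i l
    unfolding e_def using em[OF that] by measurable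
  have meas_b: "b j \<in> borel_measurable ?P" "b' j \<in> borel_measurable ?P" for j
    unfolding b_def b'_def by measurable
  have "ennreal (strip_functional k \<delta> n x) =
      (\<Sum>j<k. (\<Sum>i<n. \<Sum>l\<in>{..<n} - {i}. e j i l x) + b j x + b' j x) + ennreal (2 * \<delta> * k + 5)" for x
  proof -
    have ob: "0 \<le> (of_bool Q :: real)" for Q by simp
    have "strip_functional k \<delta> n x = (\<Sum>j<k. (\<Sum>i<n. \<Sum>l\<in>{..<n} - {i}. edge_term (real j/k) (real j/k + 1/k) n i l x)
     + of_bool (\<forall>r<n. x r \<notin> cell 0 \<delta> (real j/k) (real j/k + 1/k))
     + of_bool (\<forall>r<n. x r \<notin> cell (1 - \<delta>) 1 (real j/k) (real j/k + 1/k))) + (2 * \<delta> * k + 5)"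
      by (simp add: strip_functional_def)
    moreover have "0 \<le> 2 * \<delta> * k + 5" using \<delta> by simp
    ultimately show ?thesis
      unfolding e_def b_def b'_def
      by (simp only: ennreal_plus[symmetric] sum_ennreal sum_nonneg edge_term_nonneg ob add_nonneg_nonneg)
  qed
  then have "(\<integral>\<^sup>+x. ennreal (strip_functional k \<delta> n x) \<partial>?P) =
    (\<integral>\<^sup>+x. (\<Sum>j<k. (\<Sum>i<n. \<Sum>l\<in>{..<n} - {i}. e j i l x) + b j x + b' j x) + ennreal (2 * \<delta> * k + 5) \<partial>?P)"
    by (simp only:)
  also have "\<dots> = (\<Sum>j<k. (\<Sum>i<n. \<Sum>l\<in>{..<n} - {i}. \<integral>\<^sup>+x. e j i l x \<partial>?P) + (\<integral>\<^sup>+x. b j x \<partial>?P) + (\<integral>\<^sup>+x. b' j x \<partial>?P))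
      + ennreal (2 * \<delta> * k + 5)"
  proof -
    define E where "E j x = (\<Sum>i<n. \<Sum>l\<in>{..<n} - {i}. e j i l x)" for j x
    have meas_E: "E j \<in> borel_measurable ?P" for j
      unfolding E_def by (intro borel_measurable_sum meas_e) auto
    have "(\<integral>\<^sup>+x. E j x \<partial>?P) = (\<Sum>i<n. \<integral>\<^sup>+x. (\<Sum>l\<in>{..<n} - {i}. e j i l x) \<partial>?P)" for j
      unfolding E_def by (intro nn_integral_sum borel_measurable_sum meas_e) auto
    also have "\<dots> j = (\<Sum>i<n. \<Sum>l\<in>{..<n} - {i}. \<integral>\<^sup>+x. e j i l x \<partial>?P)" for j
      by (intro sum.cong refl nn_integral_sum meas_e) auto
    finally have int_E: "(\<integral>\<^sup>+x. E j x \<partial>?P) = (\<Sum>i<n. \<Sum>l\<in>{..<n} - {i}. \<integral>\<^sup>+x. e j i l x \<partial>?P)" for j .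
    define D where "D j x = E j x + b j x + b' j x" for j x
    have meas_D: "D j \<in> borel_measurable ?P" for j
      unfolding D_def by (intro borel_measurable_add meas_E meas_b)
    have int_D: "(\<integral>\<^sup>+x. D j x \<partial>?P) = (\<integral>\<^sup>+x. E j x \<partial>?P) + (\<integral>\<^sup>+x. b j x \<partial>?P) + (\<integral>\<^sup>+x. b' j x \<partial>?P)" for j
      unfolding D_def
      by (subst nn_integral_add, intro borel_measurable_add meas_E meas_b, rule meas_b,
          subst nn_integral_add, rule meas_E, rule meas_b, rule refl)
    have "(\<integral>\<^sup>+x. (\<Sum>j<k. D j x) + ennreal (2 * \<delta> * k + 5) \<partial>?P) =
        (\<integral>\<^sup>+x. (\<Sum>j<k. D j x) \<partial>?P) + (\<integral>\<^sup>+x. ennreal (2 * \<delta> * k + 5) \<partial>?P)"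
      by (rule nn_integral_add) (intro borel_measurable_sum meas_D, rule measurable_const, simp)
    also have "(\<integral>\<^sup>+x. (\<Sum>j<k. D j x) \<partial>?P) = (\<Sum>j<k. \<integral>\<^sup>+x. D j x \<partial>?P)"
      by (intro nn_integral_sum meas_D)
    finally show ?thesis
      unfolding int_D int_E unfolding D_def E_def by (simp only: nn_integral_const P.emeasure_space_1 mult_1_right)
  qed
  also have "\<dots> \<le> (\<Sum>j<k. (\<Sum>i<n. \<Sum>l\<in>{..<n} - {i}. ennreal A) + ennreal B + ennreal B) + ennreal (2 * \<delta> * k + 5)"
    unfolding e_def b_def b'_def ennreal_of_bool
    using \<delta> by (intro add_mono sum_mono edge avoid order.refl) auto
  also have "\<dots> = (\<Sum>j<k. (\<Sum>i<n. \<Sum>l\<in>{..<n} - {i}. ennreal A) + (ennreal B + ennreal B)) + ennreal (2 * \<delta> * k + 5)"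
    by (simp only: add.assoc)
  also have "\<dots> = ennreal ((\<Sum>j<k. (\<Sum>i<n. \<Sum>l\<in>{..<n} - {i}. A) + (B + B)) + (2 * \<delta> * k + 5))"
  proof -
    have "0 \<le> 2 * \<delta> * k + 5" using \<delta> by simp
    then show ?thesis
      using nonneg by (simp only: ennreal_plus[symmetric] sum_ennreal sum_nonneg add_nonneg_nonneg)
  qed
  also have "(\<Sum>j<k. (\<Sum>i<n. \<Sum>l\<in>{..<n} - {i}. A) + (B + B)) = k * (real n * (real n - 1) / (real n - 2)\<^sup>2 * K + 2 * B)"
  proof -
    have "(\<Sum>i<n. \<Sum>l\<in>{..<n} - {i}. A) = (\<Sum>i<n. (n - 1) * A)"
      by (intro sum.cong refl) (simp add: card_Diff_singleton)
    then show ?thesis using n by (simp add: A_def of_nat_diff)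
  qed
  finally show ?thesis using n by (simp add: B_def add.assoc of_nat_diff)
qed

lemma strip_functional_measurable:
  "strip_functional k \<delta> n \<in> borel_measurable (PiM {..<n} (\<lambda>_. borel))"
proof -
  have [measurable]: "(\<lambda>x. \<Sum>i<n. \<Sum>l\<in>{..<n} - {i}. edge_term c d n i l x) \<in> borel_measurable (PiM {..<n} (\<lambda>_. borel))"
    for c d by (intro borel_measurable_sum edge_term_measurable) auto
  have "(\<lambda>x. strip_functional k \<delta> n x) \<in> borel_measurable (PiM {..<n} (\<lambda>_. borel))"
    unfolding strip_functional_def by measurable
  then show ?thesis .
qed

section \<open>Passage to the random sequence and the limit\<close>

text \<open>By independence the joint law of the first \<open>n\<close> points is the product of
  their laws. This transfers the expectations computed on the product space to
  \<open>M\<close>.\<close>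

lemma iid_uniform_nn_integral:
  assumes iid: "iid_uniform_unit_square M X" and n: "n > 0"
    and [measurable]: "\<Phi> \<in> borel_measurable (PiM {..<n} (\<lambda>_. borel))"
  shows "(\<integral>\<^sup>+\<omega>. \<Phi> (\<lambda>i\<in>{..<n}. X i \<omega>) \<partial>M) = (\<integral>\<^sup>+x. \<Phi> x \<partial>PiM {..<n} (\<lambda>_. unit_square_uniform))"
proof -
  interpret prob_space M using iid by (simp add: iid_uniform_unit_square_def)
  have indep: "indep_vars (\<lambda>_. borel) X UNIV" and distr: "\<And>i. distr M borel (X i) = unit_square_uniform"
    using iid by (simp_all add: iid_uniform_unit_square_def)
  have rv: "\<And>i. random_variable borel (X i)" using indep by (simp add: indep_vars_def2)
  have "indep_vars (\<lambda>_. borel) X {..<n}" by (rule indep_vars_subset[OF indep]) simp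
  then have "distr M (PiM {..<n} (\<lambda>_. borel)) (\<lambda>\<omega>. \<lambda>i\<in>{..<n}. X i \<omega>) = PiM {..<n} (\<lambda>i. distr M borel (X i))"
    using n rv by (subst (asm) indep_vars_iff_distr_eq_PiM') auto
  also have "\<dots> = PiM {..<n} (\<lambda>_. unit_square_uniform)" by (simp only: distr)
  finally have eq: "PiM {..<n} (\<lambda>_. unit_square_uniform) =
    distr M (PiM {..<n} (\<lambda>_. borel)) (\<lambda>\<omega>. \<lambda>i\<in>{..<n}. X i \<omega>)" ..
  show ?thesis
    unfolding eq using rv by (subst nn_integral_distr) (auto intro!: measurable_restrict)
qed

lemma iid_uniform_AE_unit_square:
  assumes iid: "iid_uniform_unit_square M X"
  shows "AE \<omega> in M. \<forall>i. X i \<omega> \<in> cbox 0 1"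
proof -
  interpret prob_space M using iid by (simp add: iid_uniform_unit_square_def)
  have indep: "indep_vars (\<lambda>_. borel) X UNIV" and distr: "\<And>i. distr M borel (X i) = unit_square_uniform"
    using iid by (simp_all add: iid_uniform_unit_square_def)
  have rv: "\<And>i. random_variable borel (X i)" using indep by (simp add: indep_vars_def2)
  have "AE p in unit_square_uniform. p \<in> cbox 0 1" by (rule AE_uniform_measureI) auto
  then have "AE \<omega> in M. X i \<omega> \<in> cbox 0 1" for i
    by (intro AE_distrD[OF rv[of i]]) (simp only: distr)
  then show ?thesis by (simp add: AE_all_countable)
qed

text \<open>The comparison with the strip functional is made between nonnegative integrals, where
  monotonicity asks for no measurability of the makespan. If the makespan is integrable, its real
  integral is at most that of its positive part; otherwise the integral is \<open>0\<close> by
  default and the bound is nonnegative.\<close>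

lemma expected_TSPD_le:
  assumes iid: "iid_uniform_unit_square M X"
    and n: "n > 2" and k: "k > 0" and \<delta>: "0 \<le> \<delta>" "\<delta> \<le> 1" and H: "real (n - 2) / (real k)\<^sup>2 \<le> H"
    and K: "strip_constant H = ennreal K" "0 \<le> K"
  shows "(\<integral>\<omega>. TSPD_euclid \<alpha> ((\<lambda>i. X i \<omega>) ` {..<n}) \<partial>M) \<le>
    k * (real n * (real n - 1) / (real n - 2)\<^sup>2 * K + 2 * exp (- (n * \<delta> / k))) + 2 * \<delta> * k + 5"
    (is "integral\<^sup>L M ?T \<le> ?B")
proof -
  have B: "0 \<le> ?B" using K \<delta> n by (auto intro!: add_nonneg_nonneg mult_nonneg_nonneg divide_nonneg_nonneg)
  have T_le: "AE \<omega> in M. ennreal (?T \<omega>) \<le> ennreal (strip_functional k \<delta> n (\<lambda>i\<in>{..<n}. X i \<omega>))"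
    using iid_uniform_AE_unit_square[OF iid]
  proof eventually_elim
    case (elim \<omega>)
    have "(\<lambda>i. X i \<omega>) ` {..<n} = (\<lambda>i\<in>{..<n}. X i \<omega>) ` {..<n}" by simp
    then show ?case
      unfolding TSPD_euclid_def using elim k \<delta>
      by (intro ennreal_leI) (simp only:, rule TSPD_le_strip_functional, auto)
  qed
  have "(\<integral>\<^sup>+\<omega>. ennreal (?T \<omega>) \<partial>M) \<le> (\<integral>\<^sup>+\<omega>. ennreal (strip_functional k \<delta> n (\<lambda>i\<in>{..<n}. X i \<omega>)) \<partial>M)"
    by (rule nn_integral_mono_AE[OF T_le])
  also have "\<dots> = (\<integral>\<^sup>+x. ennreal (strip_functional k \<delta> n x) \<partial>PiM {..<n} (\<lambda>_. unit_square_uniform))"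
    using n strip_functional_measurable by (intro iid_uniform_nn_integral[OF iid]) auto
  also have "\<dots> \<le> ennreal ?B"
    by (rule nn_integral_strip_functional_le[OF n k \<delta> H K])
  finally have le: "(\<integral>\<^sup>+\<omega>. ennreal (?T \<omega>) \<partial>M) \<le> ennreal ?B" .
  show ?thesis
  proof (cases "integrable M ?T")
    case True
    have "integral\<^sup>L M ?T \<le> enn2real (\<integral>\<^sup>+\<omega>. ennreal (?T \<omega>) \<partial>M)"
      using real_lebesgue_integral_def[OF True] by simp
    also have "\<dots> \<le> ?B" using le B by (rule enn2real_leI[rotated])
    finally show ?thesis .
  next
    case False
    then show ?thesis using B by (simp add: not_integrable_integral_eq)
  qed
qed

text \<open>Taking \<open>k\<close> as the ceiling of \<open>sqrt n / h\<close> gives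
  \<open>(n - 2) / k\<^sup>2 \<le> h\<^sup>2\<close>, as the expectation bound with
  \<open>H = h\<^sup>2\<close> requires. After division by \<open>sqrt n\<close> the edges within
  strips tend to \<open>K / h\<close>. The rest vanishes: with
  \<open>\<delta> = n powr (- 1 / 4)\<close> both \<open>n * \<delta> / k\<close> and
  \<open>\<delta> * k\<close> are of order \<open>n powr (1 / 4)\<close>.\<close>

lemma beta_TSPD_le_strip_constant:
  assumes iid: "iid_uniform_unit_square M X" and beta: "is_beta_TSPD \<alpha> M X \<beta>" and h: "h > 0"
    and K: "strip_constant (h\<^sup>2) = ennreal K" "0 \<le> K"
  shows "\<beta> \<le> K / h"
proof -
  \<comment> \<open>The bound with \<open>k\<close> replaced by \<open>sqrt n / h + 1\<close>: free
    of the ceiling and a function of a real variable, it is open to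
    \<open>real_asymp\<close>.\<close>
  define B where "B n = (sqrt n / h + 1) * (n * (n - 1) / (n - 2)\<^sup>2 * K
      + 2 * exp (- (n * n powr (- 1 / 4) / (sqrt n / h + 1)))) + 2 * n powr (- 1 / 4) * (sqrt n / h + 1) + 5" for n :: real
  have "((\<lambda>x. B x / sqrt x) \<longlongrightarrow> inverse h * K) at_top"
    unfolding B_def using h by real_asymp
  then have "((\<lambda>x. B x / sqrt x) \<longlongrightarrow> K / h) at_top" by (simp add: divide_inverse mult.commute)
  then have lim: "(\<lambda>n. B (real n) / sqrt (real n)) \<longlonglongrightarrow> K / h"
    by (rule filterlim_compose) (rule filterlim_real_sequentially)
  have lim\<beta>: "(\<lambda>n. (\<integral>\<omega>. TSPD_euclid \<alpha> ((\<lambda>i. X i \<omega>) ` {..<n}) \<partial>M) / sqrt (real n)) \<longlonglongrightarrow> \<beta>"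
    using beta by (simp add: is_beta_TSPD_def)
  have "(\<integral>\<omega>. TSPD_euclid \<alpha> ((\<lambda>i. X i \<omega>) ` {..<n}) \<partial>M) / sqrt (real n) \<le> B (real n) / sqrt (real n)"
    if n: "n \<ge> 3" for n
  proof (rule divide_right_mono)
    define k where "k = nat \<lceil>sqrt n / h\<rceil>"
    define \<delta> where "\<delta> = real n powr (- 1 / 4)"
    have "0 < sqrt n / h" using n h by simp
    then have k: "sqrt n / h \<le> k" "k \<le> sqrt n / h + 1" unfolding k_def by linarith+
    then have k0: "k > 0" using \<open>0 < sqrt n / h\<close> by (cases "k = 0") auto
    have \<delta>: "0 \<le> \<delta>" "\<delta> \<le> 1" using n powr_mono[of "- 1 / 4" 0 "real n"] by (simp_all add: \<delta>_def)
    have "real (n - 2) / (real k)\<^sup>2 \<le> real n / (sqrt n / h)\<^sup>2"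
      using k n h \<open>0 < sqrt n / h\<close> by (intro frac_le power_mono) auto
    also have "\<dots> = h\<^sup>2" using n h by (simp add: power_divide)
    finally have "(\<integral>\<omega>. TSPD_euclid \<alpha> ((\<lambda>i. X i \<omega>) ` {..<n}) \<partial>M) \<le>
        k * (real n * (real n - 1) / (real n - 2)\<^sup>2 * K + 2 * exp (- (n * \<delta> / k))) + 2 * \<delta> * k + 5"
      using n by (intro expected_TSPD_le[OF iid _ k0 \<delta> _ K]) simp_all
    \<comment> \<open>The bound is increasing in \<open>k\<close>, also through the exponential, and
      \<open>k \<le> sqrt n / h + 1\<close>.\<close>
    also have "\<dots> \<le> (sqrt n / h + 1) * (real n * (real n - 1) / (real n - 2)\<^sup>2 * K
        + 2 * exp (- (n * \<delta> / (sqrt n / h + 1)))) + 2 * \<delta> * (sqrt n / h + 1) + 5"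
      using k k0 \<delta> n K h
      by (intro add_mono mult_mono order.refl mult_left_mono mult_right_mono)
        (auto intro!: divide_left_mono mult_nonneg_nonneg add_nonneg_nonneg add_pos_nonneg)
    also have "\<dots> = B (real n)" by (simp add: B_def \<delta>_def)
    finally show "(\<integral>\<omega>. TSPD_euclid \<alpha> ((\<lambda>i. X i \<omega>) ` {..<n}) \<partial>M) \<le> B (real n)" .
  qed simp
  then have "\<forall>n\<ge>3. (\<integral>\<omega>. TSPD_euclid \<alpha> ((\<lambda>i. X i \<omega>) ` {..<n}) \<partial>M) / sqrt (real n) \<le> B (real n) / sqrt (real n)"
    by blast
  then show ?thesis using LIMSEQ_le[OF lim\<beta> lim] by blast
qed

theorem mainTheorem14:
  fixes \<alpha> \<beta> :: real and M :: "'a measure" and X :: "nat \<Rightarrow> 'a \<Rightarrow> point"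
  assumes "\<alpha> \<ge> 1"
    and "iid_uniform_unit_square M X"
    and "is_beta_TSPD \<alpha> M X \<beta>"
  shows "(\<forall>h>0. \<beta> \<le> 1 / h *
            (LBINT z1:{0..}. LBINT u1:{0..1}. LBINT u0:{0..1}.
               exp (- z1) * sqrt (z1\<^sup>2 + h ^ 4 * (u0 - u1)\<^sup>2)))
         \<and> \<beta> \<le> sqrt (2 / sqrt 3)"
proof (intro conjI allI impI)
  fix h :: real assume h: "h > 0"
  have "h ^ 4 = (h\<^sup>2)\<^sup>2" by simp
  then show "\<beta> \<le> 1 / h * (LBINT z1:{0..}. LBINT u1:{0..1}. LBINT u0:{0..1}.
               exp (- z1) * sqrt (z1\<^sup>2 + h ^ 4 * (u0 - u1)\<^sup>2))"
    using beta_TSPD_le_strip_constant[OF assms(2,3) h strip_constant_eq_LBINT[of "h\<^sup>2"]] by simp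
next
  \<comment> \<open>Minimizes \<open>2 / h\<^sup>2 + h\<^sup>2 / 6\<close>, the square of the bound that Jensen's inequality gives.\<close>
  define h where "h = sqrt (sqrt 12)"
  have h: "h > 0" "h\<^sup>2 = sqrt 12" by (simp_all add: h_def)
  define K where "K = enn2real (strip_constant (h\<^sup>2))"
  \<comment> \<open>The bound by \<open>2\<close> makes the strip constant finite, so
    \<open>enn2real\<close> preserves its value.\<close>
  have K: "strip_constant (h\<^sup>2) = ennreal K" "0 \<le> K"
    using le_less_trans[OF strip_constant_sqrt_12, of top] by (simp_all add: K_def h)
  have "\<beta> \<le> K / h" by (rule beta_TSPD_le_strip_constant[OF assms(2,3) h(1) K])
  also have "K \<le> 2"
    using strip_constant_sqrt_12 K ennreal_le_iff[of 2 K] by (simp add: h)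
  also have "2 / h = sqrt (2 / sqrt 3)"
  proof -
    have "(2 / h)\<^sup>2 = 2 / sqrt 3"
    proof -
      have "sqrt 12 = 2 * sqrt (3::real)" using real_sqrt_mult[of 4 3] by simp
      then show ?thesis by (simp add: power_divide h)
    qed
    then show ?thesis using h by (metis real_sqrt_unique divide_nonneg_pos zero_le_numeral)
  qed
  finally show "\<beta> \<le> sqrt (2 / sqrt 3)" using h by (simp add: divide_right_mono)
qed

end
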